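(* Let $m\in(0,|B_1|)$. Then there exist $\bar\delta>0$ and a positive constant $C=C(m,n)$ such that for every $\delta\in(0,\bar\delta)$, $$\frac1C\,\delta^2\le\|u_{B_*}\|_{L^\infty(B_1)}-\|u_{A_\delta}\|_{L^\infty(B_1)}\le C\,\delta^2.$$
   Context: $B_1$ is the open unit ball of $\mathbb{R}^n$ ($n\ge1$) centered at the origin, $B_r$ is the open ball of radius $r$ centered at the origin, $|\cdot|$ on sets denotes Lebesgue measure. For a measurable set $E\subset B_1$, $u_E\in H^1_0(B_1)$ is the unique weak solution of $-\Delta u_E=\chi_E$ in $B_1$, $u_E=0$ on $\partial B_1$. $B_*$ is the ball centered at the origin with $|B_*|=m$, and $r_*$ is its radius. For $\delta\in(0,\min\{2m,2(|B_1|-m)\})$, $$A_\delta=B_{r_1(\delta)}\cup\{x\in\mathbb{R}^n: r_*<|x|<r_2(\delta)\},\quad r_1(\delta)=\frac{(m-\delta/2)^{1/n}}{|B_1|^{1/n}},\quad r_2(\delta)=\frac{(m+\delta/2)^{1/n}}{|B_1|^{1/n}},$$ so that $|A_\delta|=m$ and $|A_\delta\Delta B_*|=\delta$. *)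

theory Defs
  imports "HOL-Analysis.Analysis" "HOL-Probability.Essential_Supremum"
begin

section \<open>Test functions\<close>

definition partial_deriv :: "('a::euclidean_space \<Rightarrow> real) \<Rightarrow> 'a \<Rightarrow> 'a \<Rightarrow> real" where
  "partial_deriv f i x = frechet_derivative f (at x) i"

definition gradient :: "('a::euclidean_space \<Rightarrow> real) \<Rightarrow> 'a \<Rightarrow> 'a" where
  "gradient f x = (\<Sum>i\<in>Basis. partial_deriv f i x *\<^sub>R i)"

primrec C_k :: "nat \<Rightarrow> ('a::euclidean_space \<Rightarrow> real) \<Rightarrow> bool" where
  "C_k 0 f \<longleftrightarrow> continuous_on UNIV f"
| "C_k (Suc k) f \<longleftrightarrow>
     (\<forall>x. f differentiable (at x)) \<and> (\<forall>i\<in>Basis. C_k k (partial_deriv f i))"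

definition test_functions :: "'a::euclidean_space set \<Rightarrow> ('a \<Rightarrow> real) set" where
  "test_functions \<Omega> =
     {\<phi>. (\<forall>k. C_k k \<phi>) \<and> compact (closure {x. \<phi> x \<noteq> 0}) \<and> closure {x. \<phi> x \<noteq> 0} \<subseteq> \<Omega>}"

section \<open>Sobolev functions and weak solutions\<close>

definition L2_on :: "'a::euclidean_space set \<Rightarrow> ('a \<Rightarrow> 'b::euclidean_space) \<Rightarrow> bool" where
  "L2_on \<Omega> f \<longleftrightarrow>
     f \<in> borel_measurable (lebesgue_on \<Omega>) \<and> integrable (lebesgue_on \<Omega>) (\<lambda>x. (norm (f x))\<^sup>2)"

text \<open>Sobolev functions are handled together with their weak gradient, which is
  determined almost everywhere: \<open>has_H1_gradient \<Omega> u g\<close> says that \<open>u\<close> belongs to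
  \<open>H\<^sup>1(\<Omega>)\<close> and has weak gradient \<open>g\<close>. The space \<open>H\<^sup>1\<^sub>0(\<Omega>)\<close> is the closure of the
  test functions in the \<open>H\<^sup>1\<close> norm.\<close>

definition has_H1_gradient ::
  "'a::euclidean_space set \<Rightarrow> ('a \<Rightarrow> real) \<Rightarrow> ('a \<Rightarrow> 'a) \<Rightarrow> bool" where
  "has_H1_gradient \<Omega> u g \<longleftrightarrow>
     L2_on \<Omega> u \<and> L2_on \<Omega> g \<and>
     (\<forall>\<phi>\<in>test_functions \<Omega>. \<forall>i\<in>Basis.
        (\<integral>x. u x * partial_deriv \<phi> i x \<partial>lebesgue_on \<Omega>) =
        - (\<integral>x. (g x \<bullet> i) * \<phi> x \<partial>lebesgue_on \<Omega>))"

definition has_H10_gradient ::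
  "'a::euclidean_space set \<Rightarrow> ('a \<Rightarrow> real) \<Rightarrow> ('a \<Rightarrow> 'a) \<Rightarrow> bool" where
  "has_H10_gradient \<Omega> u g \<longleftrightarrow>
     has_H1_gradient \<Omega> u g \<and>
     (\<exists>\<phi>. (\<forall>k. \<phi> k \<in> test_functions \<Omega>) \<and>
       (\<lambda>k::nat. (\<integral>x. (\<phi> k x - u x)\<^sup>2 \<partial>lebesgue_on \<Omega>)
                 + (\<integral>x. (norm (gradient (\<phi> k) x - g x))\<^sup>2 \<partial>lebesgue_on \<Omega>)) \<longlonglongrightarrow> 0)"

text \<open>Weak solution of \<open>-\<Delta>u = f\<close> in \<open>\<Omega>\<close>, \<open>u = 0\<close> on the boundary of \<open>\<Omega>\<close>.\<close>

definition weak_Dirichlet_solution ::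
  "'a::euclidean_space set \<Rightarrow> ('a \<Rightarrow> real) \<Rightarrow> ('a \<Rightarrow> real) \<Rightarrow> bool" where
  "weak_Dirichlet_solution \<Omega> f u \<longleftrightarrow>
     (\<exists>g. has_H10_gradient \<Omega> u g \<and>
       (\<forall>v h. has_H10_gradient \<Omega> v h \<longrightarrow>
          (\<integral>x. g x \<bullet> h x \<partial>lebesgue_on \<Omega>) = (\<integral>x. f x * v x \<partial>lebesgue_on \<Omega>)))"

text \<open>The weak solution \<open>u\<^sub>E\<close> is unique only up to null sets; \<open>u_sol E\<close> is some representative.\<close>

definition u_sol :: "'a::euclidean_space set \<Rightarrow> 'a \<Rightarrow> real" where
  "u_sol E = (SOME u. weak_Dirichlet_solution (ball 0 1) (indicator E) u)"

text \<open>Extended-real valued, so that an unbounded function has norm \<open>\<infinity>\<close>.\<close>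

definition Linf_norm :: "'a::euclidean_space set \<Rightarrow> ('a \<Rightarrow> real) \<Rightarrow> ereal" where
  "Linf_norm \<Omega> u = esssup (lebesgue_on \<Omega>) (\<lambda>x. ereal \<bar>u x\<bar>)"

section \<open>The sets \<open>B\<^sub>*\<close> and \<open>A\<^sub>\<delta>\<close>\<close>

text \<open>The type argument fixes the ambient space.\<close>

definition r_star :: "'a::euclidean_space itself \<Rightarrow> real \<Rightarrow> real" where
  "r_star _ m = (THE r. 0 < r \<and> measure lebesgue (ball (0::'a) r) = m)"

definition B_star :: "real \<Rightarrow> 'a::euclidean_space set" where
  "B_star m = ball 0 (r_star TYPE('a) m)"

definition r1 :: "'a::euclidean_space itself \<Rightarrow> real \<Rightarrow> real \<Rightarrow> real" where
  "r1 _ m \<delta> = (m - \<delta> / 2) powr (1 / real DIM('a)) /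
              measure lebesgue (ball (0::'a) 1) powr (1 / real DIM('a))"

definition r2 :: "'a::euclidean_space itself \<Rightarrow> real \<Rightarrow> real \<Rightarrow> real" where
  "r2 _ m \<delta> = (m + \<delta> / 2) powr (1 / real DIM('a)) /
              measure lebesgue (ball (0::'a) 1) powr (1 / real DIM('a))"

definition A_set :: "real \<Rightarrow> real \<Rightarrow> 'a::euclidean_space set" where
  "A_set m \<delta> = ball 0 (r1 TYPE('a) m \<delta>) \<union>
     {x. r_star TYPE('a) m < norm x \<and> norm x < r2 TYPE('a) m \<delta>}"

end

theory Submission
  imports Defs "HOL-Computational_Algebra.Polynomial"
begin

text \<open>For a centred ball of volume parameter \<open>s\<close>, that is \<open>|x|\<^sup>n < s\<close>, the solution is explicit: its
  gradient is \<open>- min(1, s/|x|\<^sup>n) x / n\<close>. Solutions depend linearly on the right-hand side, and up to a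
  null set the indicator of \<open>A\<^sub>\<delta>\<close> is the sum of the indicators of the balls with parameters \<open>\<mu> - h\<close> and
  \<open>\<mu> + h\<close> minus that of \<open>B\<^sub>*\<close>, where \<open>\<mu> = m/|B\<^sub>1|\<close> and \<open>h = \<delta>/(2|B\<^sub>1|)\<close>. Both solutions are radially
  decreasing, so their norms are their values at the origin, and the deficit is the second difference
  \<open>2 \<psi>(\<mu>) - \<psi>(\<mu> + h) - \<psi>(\<mu> - h)\<close> of \<open>\<psi>(s)\<close>, the value at the origin of the solution for the ball with
  parameter \<open>s\<close>. Since \<open>min(1, s/\<sigma>)\<close> is concave in \<open>s\<close> with a kink at \<open>\<sigma>\<close>, the radial derivative of
  the difference of the solutions is at most of order \<open>h\<close>, is supported in an annulus of width of order
  \<open>h\<close> around the boundary of \<open>B\<^sub>*\<close>, has one sign, and is of exact order \<open>h\<close> in the middle of that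
  annulus. This gives a deficit of order \<open>h\<^sup>2\<close> from both sides
  (\<open>second_difference_estimate\<close>, \<open>Linf_deficit\<close>).

  The remaining work justifies the explicit solution in the Sobolev sense. The weak equation for a ball
  (\<open>flux_through_spheres\<close>) comes from dilation invariance of Lebesgue measure instead of the divergence
  theorem. A radial function with a \<open>C\<^sup>1\<close> profile that vanishes at the boundary lies in \<open>H\<^sup>1\<^sub>0\<close>
  (\<open>radial_has_H10_gradient\<close>); its smooth approximations are polynomials in \<open>|x|\<^sup>2\<close> times a cutoff made
  from \<open>e\<^sup>-\<^sup>1\<^sup>/\<^sup>s\<close>. Finally, the representative chosen in the definition of \<open>u_sol\<close> agrees almost
  everywhere with the explicit one by uniqueness (\<open>weak_solution_unique\<close>), which rests on the Poincare
  inequality.\<close>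

section \<open>Calculus of smooth functions\<close>

lemma partial_deriv_eq:
  assumes "(f has_derivative f') (at x)"
  shows "partial_deriv f i x = f' i"
  unfolding partial_deriv_def using frechet_derivative_at[OF assms] by simp

lemma has_derivative_gradient:
  assumes "f differentiable (at x)"
  shows "(f has_derivative (\<lambda>v. gradient f x \<bullet> v)) (at x)"
proof -
  have d: "(f has_derivative frechet_derivative f (at x)) (at x)"
    using assms by (simp add: frechet_derivative_works)
  then have l: "linear (frechet_derivative f (at x))"
    using has_derivative_bounded_linear bounded_linear.linear by blast
  have "frechet_derivative f (at x) v = gradient f x \<bullet> v" for v
  proof -
    have "frechet_derivative f (at x) v = frechet_derivative f (at x) (\<Sum>i\<in>Basis. (v \<bullet> i) *\<^sub>R i)"
      by (simp add: euclidean_representation)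
    also have "\<dots> = (\<Sum>i\<in>Basis. (v \<bullet> i) * frechet_derivative f (at x) i)"
      using l by (simp add: linear_sum linear_cmul)
    also have "\<dots> = gradient f x \<bullet> v"
      by (simp add: gradient_def partial_deriv_def inner_sum_left inner_commute[of v] mult.commute)
    finally show ?thesis .
  qed
  then have "frechet_derivative f (at x) = (\<lambda>v. gradient f x \<bullet> v)" by blast
  with d show ?thesis by simp
qed

lemma gradient_eqI:
  assumes "(f has_derivative (\<lambda>v. g \<bullet> v)) (at x)"
  shows "gradient f x = g"
  by (simp add: gradient_def partial_deriv_eq[OF assms] euclidean_representation)

lemma gradient_inner_Basis: "i \<in> Basis \<Longrightarrow> gradient f x \<bullet> i = partial_deriv f i x"
  by (simp add: gradient_def inner_sum_left inner_Basis if_distrib cong: if_cong)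

lemma C_k_continuous: "C_k k f \<Longrightarrow> continuous_on UNIV f"
  by (cases k) (auto simp: continuous_at_imp_continuous_on differentiable_imp_continuous_within)

lemma C_k_SucD: "C_k (Suc k) f \<Longrightarrow> C_k k f"
proof (induction k arbitrary: f)
  case 0
  show ?case using C_k_continuous[OF 0] by simp
next
  case (Suc k)
  show ?case
    unfolding C_k.simps(2)[of k]
    using Suc.prems[unfolded C_k.simps(2)[of "Suc k"]] Suc.IH by blast
qed

lemma C_k_Suc_I:
  assumes "\<And>x. (f has_derivative f' x) (at x)"
    and "\<And>i. i \<in> Basis \<Longrightarrow> C_k k (\<lambda>x. f' x i)"
  shows "C_k (Suc k) f"
proof -
  have "partial_deriv f i = (\<lambda>x. f' x i)" for i
    using partial_deriv_eq[OF assms(1)] by blast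
  then show ?thesis using assms by (auto simp: differentiable_def)
qed

lemma C_k_SucE:
  assumes "C_k (Suc k) f"
  shows "(f has_derivative frechet_derivative f (at x)) (at x)"
    and "i \<in> Basis \<Longrightarrow> C_k k (\<lambda>x. frechet_derivative f (at x) i)"
proof -
  show "(f has_derivative frechet_derivative f (at x)) (at x)"
    using assms by (simp add: frechet_derivative_works)
  have "partial_deriv f i = (\<lambda>x. frechet_derivative f (at x) i)"
    by (simp add: partial_deriv_def fun_eq_iff)
  then show "i \<in> Basis \<Longrightarrow> C_k k (\<lambda>x. frechet_derivative f (at x) i)"
    using assms by auto
qed

lemma C_k_const: "C_k k (\<lambda>x. c)"
proof (induction k arbitrary: c)
  case (Suc k)
  show ?case by (rule C_k_Suc_I[where f'="\<lambda>_ _. 0"]) (auto intro: Suc)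
qed simp

lemma C_k_inner: "C_k k (\<lambda>x. x \<bullet> b)"
proof (cases k)
  case (Suc k)
  show ?thesis unfolding Suc
    by (rule C_k_Suc_I[where f'="\<lambda>_ v. v \<bullet> b"])
      (auto intro!: derivative_eq_intros C_k_const)
qed (auto intro!: continuous_intros)

lemma C_k_add: "C_k k f \<Longrightarrow> C_k k g \<Longrightarrow> C_k k (\<lambda>x. f x + g x)"
proof (induction k arbitrary: f g)
  case 0
  then show ?case by (auto intro!: continuous_intros)
next
  case (Suc k)
  show ?case
    by (rule C_k_Suc_I[OF has_derivative_add[OF C_k_SucE(1)[OF Suc.prems(1)] C_k_SucE(1)[OF Suc.prems(2)]]])
      (intro Suc.IH C_k_SucE(2) Suc.prems)
qed

lemma C_k_sum: "finite I \<Longrightarrow> (\<And>i. i \<in> I \<Longrightarrow> C_k k (f i)) \<Longrightarrow> C_k k (\<lambda>x. \<Sum>i\<in>I. f i x)"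
  by (induction I rule: finite_induct) (auto intro: C_k_add C_k_const)

lemma C_k_mult: "C_k k f \<Longrightarrow> C_k k g \<Longrightarrow> C_k k (\<lambda>x. f x * g x)"
proof (induction k arbitrary: f g)
  case 0
  then show ?case by (auto intro!: continuous_intros)
next
  case (Suc k)
  show ?case
    by (rule C_k_Suc_I[OF has_derivative_mult[OF C_k_SucE(1)[OF Suc.prems(1)] C_k_SucE(1)[OF Suc.prems(2)]]])
      (intro Suc.IH C_k_add C_k_SucE(2) Suc.prems C_k_SucD[OF Suc.prems(1)] C_k_SucD[OF Suc.prems(2)])
qed

lemma C_k_power: "C_k k f \<Longrightarrow> C_k k (\<lambda>x. f x ^ j)"
  by (induction j) (auto intro: C_k_const C_k_mult)

lemma C_k_compose:
  fixes f :: "real \<Rightarrow> real"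
  shows "C_k k f \<Longrightarrow> C_k k g \<Longrightarrow> C_k k (\<lambda>x. f (g x))"
proof (induction k arbitrary: f g)
  case 0
  then show ?case by (auto intro: continuous_on_compose2)
next
  case (Suc k)
  let ?f' = "\<lambda>y. frechet_derivative f (at y)" and ?g' = "\<lambda>x. frechet_derivative g (at x)"
  have l: "?f' y (c::real) = c * ?f' y 1" for y c
    using linear_cmul[OF bounded_linear.linear[OF has_derivative_bounded_linear[OF C_k_SucE(1)[OF Suc.prems(1)]]], of y c 1]
    by simp
  have "C_k k (\<lambda>x. ?g' x i * ?f' (g x) 1)" if "i \<in> Basis" for i
    using C_k_mult[OF C_k_SucE(2)[OF Suc.prems(2) that]
        Suc.IH[OF C_k_SucE(2)[OF Suc.prems(1)] C_k_SucD[OF Suc.prems(2)]]] by simp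
  then have "C_k k (\<lambda>x. ?f' (g x) (?g' x i))" if "i \<in> Basis" for i
    using that by (subst l)
  then show ?case
    by (intro C_k_Suc_I[where f'="\<lambda>x v. ?f' (g x) (?g' x v)"])
      (auto intro: has_derivative_compose[OF C_k_SucE(1)[OF Suc.prems(2)] C_k_SucE(1)[OF Suc.prems(1)]])
qed

lemma C_k_Suc_real:
  fixes f :: "real \<Rightarrow> real"
  assumes "\<And>x. (f has_real_derivative f' x) (at x)" and "C_k k f'"
  shows "C_k (Suc k) f"
  by (rule C_k_Suc_I[where f'="\<lambda>x h. f' x * h"])
    (use assms in \<open>auto simp: has_field_derivative_def\<close>)

text \<open>\<open>flat_exp p\<close> is \<open>p(1/s) e\<^sup>-\<^sup>1\<^sup>/\<^sup>s\<close>, extended by \<open>0\<close> to \<open>s \<le> 0\<close>. Carrying the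
  polynomial \<open>p\<close> along makes the family closed under differentiation, so that smoothness of the
  single function \<open>flat_exp 1\<close> follows by an induction over all \<open>p\<close> at once.\<close>
definition flat_exp :: "real poly \<Rightarrow> real \<Rightarrow> real" where
  "flat_exp p s = (if 0 < s then poly p (1 / s) * exp (- (1 / s)) else 0)"

lemma poly_exp_tendsto_0: "((\<lambda>y. poly p y * exp (- y)) \<longlongrightarrow> (0::real)) at_top"
proof -
  have "((\<lambda>y. \<Sum>i\<le>degree p. coeff p i * (y ^ i / exp y)) \<longlongrightarrow> (\<Sum>i\<le>degree p. coeff p i * 0)) at_top"
    by (intro tendsto_intros tendsto_power_div_exp_0)
  then show ?thesis
    by (simp add: poly_altdef exp_minus divide_inverse sum_distrib_right mult.assoc)
qed

lemma flat_exp_deriv: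
  "(flat_exp p has_real_derivative flat_exp ([:0,0,1:] * (p - pderiv p)) s) (at s)"
proof -
  consider "0 < s" | "s < 0" | "s = 0" by linarith
  then show ?thesis
  proof cases
    case 1
    have "((\<lambda>s. poly p (1 / s) * exp (- (1 / s))) has_real_derivative
            flat_exp ([:0,0,1:] * (p - pderiv p)) s) (at s)"
      using 1 by (auto intro!: derivative_eq_intros simp: flat_exp_def power2_eq_square)
         (simp add: field_simps)
    moreover have "eventually (\<lambda>s. poly p (1 / s) * exp (- (1 / s)) = flat_exp p s) (nhds s)"
      using eventually_nhds_in_open[of "{0<..}" s] 1 by (auto simp: flat_exp_def elim!: eventually_mono)
    ultimately show ?thesis by (subst (asm) DERIV_cong_ev[OF refl _ refl])
  next
    case 2
    have "eventually (\<lambda>s. 0 = flat_exp p s) (nhds s)"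
      using eventually_nhds_in_open[of "{..<0}" s] 2 by (auto simp: flat_exp_def elim!: eventually_mono)
    then have "((\<lambda>s. 0) has_real_derivative 0) (at s) \<longleftrightarrow> (flat_exp p has_real_derivative 0) (at s)"
      by (intro DERIV_cong_ev) auto
    then show ?thesis using 2 by (simp add: flat_exp_def)
  next
    case 3
    have "((\<lambda>h. flat_exp p h / h) \<longlongrightarrow> 0) (at_right 0)"
    proof (rule Lim_transform_eventually)
      show "((\<lambda>h::real. poly ([:0,1:] * p) (inverse h) * exp (- (inverse h))) \<longlongrightarrow> 0) (at_right 0)"
        by (rule filterlim_compose[OF poly_exp_tendsto_0 filterlim_inverse_at_top_right])
      show "\<forall>\<^sub>F h in at_right 0. poly ([:0,1:] * p) (inverse h) * exp (- (inverse h)) = flat_exp p h / h"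
        using eventually_at_right_less[of "0::real"]
        by (rule eventually_mono) (simp add: flat_exp_def field_simps)
    qed
    moreover have "((\<lambda>h. flat_exp p h / h) \<longlongrightarrow> 0) (at_left 0)"
      by (rule tendsto_eventually)
        (auto simp: eventually_at_filter flat_exp_def)
    ultimately have "((\<lambda>h. flat_exp p h / h) \<longlongrightarrow> 0) (at 0)"
      by (rule filterlim_split_at[rotated])
    then show ?thesis by (simp add: DERIV_def 3 flat_exp_def)
  qed
qed

lemma C_k_flat_exp: "C_k k (flat_exp p)"
proof (induction k arbitrary: p)
  case 0
  have "isCont (flat_exp p) x" for x using flat_exp_deriv DERIV_isCont by blast
  then show ?case by (simp add: continuous_at_imp_continuous_on)
next
  case (Suc k)
  show ?case by (rule C_k_Suc_real[OF flat_exp_deriv Suc])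
qed

section \<open>Integration by parts through translations and dilations\<close>

lemma lborel_integral_affine:
  fixes f :: "'a::euclidean_space \<Rightarrow> real"
  assumes "c > 0" and [measurable]: "f \<in> borel_measurable borel"
  shows "(\<integral>x. f x \<partial>lborel) = c ^ DIM('a) * (\<integral>x. f (t + c *\<^sub>R x) \<partial>lborel)"
proof -
  have "(\<integral>x. f x \<partial>lborel) = (\<integral>x. f x \<partial>density (distr lborel borel (\<lambda>x. t + c *\<^sub>R x)) (\<lambda>_. ennreal (c ^ DIM('a))))"
    using assms lborel_affine[of c t] by (simp add: ennreal_power)
  also have "\<dots> = c ^ DIM('a) * (\<integral>x. f (t + c *\<^sub>R x) \<partial>lborel)"
    using assms by (subst integral_density) (auto simp: integral_distr)
  finally show ?thesis .
qed

lemma integrable_bounded_support: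
  fixes f :: "'a::euclidean_space \<Rightarrow> real"
  assumes [measurable]: "f \<in> borel_measurable borel"
    and "\<And>x. \<bar>f x\<bar> \<le> B * indicator (cball 0 R) x"
  shows "integrable lborel f"
proof (rule Bochner_Integration.integrable_bound)
  have "emeasure lborel (cball (0::'a) R) < \<infinity>"
    by (intro emeasure_bounded_finite) auto
  then show "integrable lborel (\<lambda>x. B * indicator (cball (0::'a) R) x)" by simp
  show "AE x in lborel. norm (f x) \<le> norm (B * indicator (cball 0 R) x)"
    using assms(2) by (intro AE_I2) (metis abs_ge_self order_trans real_norm_def)
qed simp

lemma bounded_of_compact_support:
  fixes f :: "'a::euclidean_space \<Rightarrow> 'b::real_normed_vector"
  assumes "continuous_on UNIV f" and "\<And>x. norm x > R \<Longrightarrow> f x = 0"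
  obtains B where "B \<ge> 0" and "\<And>x. norm (f x) \<le> B" and "\<And>x. norm (f x) \<le> B * indicator (cball 0 R) x"
proof -
  have "compact (f ` cball 0 R)"
    using assms(1) by (intro compact_continuous_image) (auto intro: continuous_on_subset)
  then obtain B where B: "B > 0" "\<And>x. x \<in> cball 0 R \<Longrightarrow> norm (f x) \<le> B"
    using compact_imp_bounded bounded_pos by (metis imageI)
  have "norm (f x) \<le> B * indicator (cball 0 R) x" for x
    using B(2)[of x] assms(2)[of x] B(1) by (cases "x \<in> cball 0 R") auto
  moreover have "norm (f x) \<le> B" for x
    using B(2)[of x] assms(2)[of x] B(1) by (cases "x \<in> cball 0 R") auto
  ultimately show ?thesis using that[of B] B by force
qed

lemma integrable_compact_support:
  fixes f :: "'a::euclidean_space \<Rightarrow> real"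
  assumes "continuous_on UNIV f" and "\<And>x. norm x > R \<Longrightarrow> f x = 0"
  shows "integrable lborel f"
proof -
  obtain B where "\<And>x. norm (f x) \<le> B * indicator (cball 0 R) x"
    using bounded_of_compact_support[OF assms] by blast
  then show ?thesis
    using assms(1) by (intro integrable_bounded_support[of f B R]) (auto intro: borel_measurable_continuous_onI)
qed

lemma AE_norm_neq: "AE x in lborel. norm (x::'a::euclidean_space) \<noteq> r"
proof -
  have "sphere (0::'a) r \<in> null_sets lborel"
    using negligible_sphere[of "0::'a" r] negligible_iff_null_sets null_sets_completion_iff by force
  then have "AE x in lborel. x \<notin> sphere (0::'a) r" by (rule AE_not_in)
  then show ?thesis by simp
qed

text \<open>Translation invariance makes the integral of every difference quotient of \<open>\<psi>\<close> vanish, and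
  dominated convergence passes to the derivative.\<close>
lemma integral_directional_derivative_zero:
  fixes \<psi> :: "'a::euclidean_space \<Rightarrow> real"
  assumes d: "\<And>x. ((\<lambda>t. \<psi> (x + t *\<^sub>R b)) has_real_derivative \<psi>' x) (at 0)"
    and c: "continuous_on UNIV \<psi>" and c': "continuous_on UNIV \<psi>'"
    and z: "\<And>x. norm x > R \<Longrightarrow> \<psi> x = 0" and z': "\<And>x. norm x > R \<Longrightarrow> \<psi>' x = 0"
    and b: "norm b \<le> 1"
  shows "(\<integral>x. \<psi>' x \<partial>lborel) = 0"
proof -
  have [measurable]: "\<psi> \<in> borel_measurable borel" "\<psi>' \<in> borel_measurable borel"
    using c c' by (auto intro: borel_measurable_continuous_onI)
  define s where "s k x = real (Suc k) * (\<psi> (x + (1 / real (Suc k)) *\<^sub>R b) - \<psi> x)" for k x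
  obtain M where M: "M \<ge> 0" "\<And>x. norm (\<psi>' x) \<le> M"
    using bounded_of_compact_support[OF c' z'] by metis
  have d': "((\<lambda>t. \<psi> (x + t *\<^sub>R b)) has_real_derivative \<psi>' (x + u *\<^sub>R b)) (at u)" for x u
  proof -
    have "((\<lambda>t. \<psi> ((x + u *\<^sub>R b) + (t - u) *\<^sub>R b)) has_real_derivative \<psi>' (x + u *\<^sub>R b)) (at u)"
      using DERIV_shift[of "\<lambda>t. \<psi> ((x + u *\<^sub>R b) + t *\<^sub>R b)" "\<psi>' (x + u *\<^sub>R b)" u "-u"] d[of "x + u *\<^sub>R b"]
      by simp
    then show ?thesis by (simp add: algebra_simps)
  qed
  have int\<psi>: "integrable lborel \<psi>" using integrable_compact_support[OF c z] by simp
  have zero: "(\<integral>x. s k x \<partial>lborel) = 0" for k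
  proof -
    let ?t = "(1 / real (Suc k)) *\<^sub>R b"
    have "(\<integral>x. \<psi> (?t + x) \<partial>lborel) = (\<integral>x. \<psi> x \<partial>lborel)"
      using lborel_integral_affine[of 1 \<psi> ?t] by simp
    moreover have "integrable lborel (\<lambda>x. \<psi> (x + ?t))"
    proof (rule integrable_compact_support)
      show "continuous_on UNIV (\<lambda>x. \<psi> (x + ?t))"
        by (intro continuous_on_compose2[OF c] continuous_intros) auto
      show "\<psi> (x + ?t) = 0" if "R + norm ?t < norm x" for x
        using that norm_triangle_ineq4[of "x + ?t" ?t] by (intro z) simp
    qed
    ultimately show ?thesis
      unfolding s_def using int\<psi> by (simp add: add.commute)
  qed
  have "(\<lambda>k. \<integral>x. s k x \<partial>lborel) \<longlonglongrightarrow> (\<integral>x. \<psi>' x \<partial>lborel)"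
  proof (rule integral_dominated_convergence)
    show "integrable lborel (\<lambda>x. M * indicator (cball (0::'a) (R + 1)) x)"
      using emeasure_bounded_finite[OF bounded_cball[of "0::'a" "R+1"]] by simp
    show "AE x in lborel. (\<lambda>k. s k x) \<longlonglongrightarrow> \<psi>' x"
    proof (intro AE_I2)
      fix x
      have "((\<lambda>t. (\<psi> (x + t *\<^sub>R b) - \<psi> x) / t) \<longlongrightarrow> \<psi>' x) (at 0)"
        using d[of x] by (simp add: DERIV_def)
      moreover have "filterlim (\<lambda>k. 1 / real (Suc k)) (at 0) sequentially"
        unfolding filterlim_at using LIMSEQ_inverse_real_of_nat by (simp add: inverse_eq_divide)
      ultimately have "(\<lambda>k. (\<psi> (x + (1 / real (Suc k)) *\<^sub>R b) - \<psi> x) / (1 / real (Suc k))) \<longlonglongrightarrow> \<psi>' x"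
        by (rule filterlim_compose)
      then show "(\<lambda>k. s k x) \<longlonglongrightarrow> \<psi>' x" by (simp add: s_def mult.commute)
    qed
    show "AE x in lborel. norm (s k x) \<le> M * indicator (cball (0::'a) (R + 1)) x" for k
    proof (intro AE_I2)
      fix x
      show "norm (s k x) \<le> M * indicator (cball (0::'a) (R + 1)) x"
      proof (cases "x \<in> cball 0 (R + 1)")
        case True
        obtain \<xi> where "\<psi> (x + (1 / real (Suc k)) *\<^sub>R b) - \<psi> (x + 0 *\<^sub>R b) = (1 / real (Suc k) - 0) * \<psi>' (x + \<xi> *\<^sub>R b)"
          using MVT2[of 0 "1 / real (Suc k)" "\<lambda>t. \<psi> (x + t *\<^sub>R b)" "\<lambda>t. \<psi>' (x + t *\<^sub>R b)"] d' by auto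
        then have "s k x = \<psi>' (x + \<xi> *\<^sub>R b)" by (simp add: s_def)
        then show ?thesis using True M(2) by simp
      next
        case False
        have "norm ((1 / real (Suc k)) *\<^sub>R b) \<le> 1" using b by (simp add: divide_simps)
        then have "norm (x + (1 / real (Suc k)) *\<^sub>R b) > R" "norm x > R"
          using False norm_diff_ineq[of x "(1 / real (Suc k)) *\<^sub>R b"]
          unfolding mem_cball dist_0_norm by linarith+
        then show ?thesis using False z by (simp add: s_def)
      qed
    qed
  qed (auto simp: s_def)
  then have "(\<lambda>k. 0) \<longlonglongrightarrow> (\<integral>x. \<psi>' x \<partial>lborel)" by (simp only: zero)
  then show ?thesis by (simp add: LIMSEQ_const_iff)
qed

text \<open>This is the weak form of \<open>div (min(1, s/|x|\<^sup>n) x) = n \<chi>\<close> with \<open>\<chi>\<close> the indicator of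
  \<open>|x|\<^sup>n < s\<close>, that is, Newton's theorem on the field of a homogeneous ball. Write
  \<open>K(x) = min(1, s/|x|\<^sup>n)\<close>. The radial derivative \<open>G x \<bullet> x\<close> is the derivative of
  \<open>\<phi>(\<lambda> x)\<close> at \<open>\<lambda> = 1\<close>, and dilation invariance of Lebesgue measure moves \<open>\<lambda>\<close>
  from \<open>\<phi>\<close> to the kernel: \<open>\<integral> K(x) \<phi>(\<lambda> x) = \<integral> \<lambda>\<^sup>-\<^sup>n K(y/\<lambda>) \<phi>(y)\<close>. But
  \<open>\<lambda>\<^sup>-\<^sup>n K(y/\<lambda>) = s / max (\<lambda>\<^sup>n s) (|y|\<^sup>n)\<close> is constant in \<open>\<lambda>\<close> near \<open>1\<close> outside the
  ball and equals \<open>\<lambda>\<^sup>-\<^sup>n\<close> inside, so its derivative is \<open>-n \<chi>\<close> almost everywhere. This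
  avoids polar coordinates and any differentiation of \<open>K\<close>, which has a kink on the sphere.\<close>
lemma flux_through_spheres:
  fixes \<phi> :: "'a::euclidean_space \<Rightarrow> real" and G :: "'a \<Rightarrow> 'a"
  assumes d: "\<And>x. (\<phi> has_derivative (\<lambda>v. G x \<bullet> v)) (at x)"
    and cG: "continuous_on UNIV G"
    and z: "\<And>x. norm x > R \<Longrightarrow> \<phi> x = 0" and zG: "\<And>x. norm x > R \<Longrightarrow> G x = 0"
    and s: "s > 0"
  shows "(\<integral>x. s / max s (norm x ^ DIM('a)) * (G x \<bullet> x) \<partial>lborel)
           = - real DIM('a) * (\<integral>x. indicator {x. norm x ^ DIM('a) < s} x * \<phi> x \<partial>lborel)"
proof -
  define n where "n = DIM('a)"
  have n: "n > 0" by (simp add: n_def)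
  have c: "continuous_on UNIV \<phi>"
    using d by (auto intro!: has_derivative_continuous continuous_at_imp_continuous_on)
  have [measurable]: "\<phi> \<in> borel_measurable borel" "G \<in> borel_measurable borel"
    using c cG by (auto intro: borel_measurable_continuous_onI)
  define K where "K x = s / max s (norm x ^ n)" for x :: 'a
  have cK: "continuous_on UNIV K"
    unfolding K_def using s n by (intro continuous_intros) (auto simp: max_def zero_power)
  have K: "0 \<le> K x" "K x \<le> 1" for x using s by (auto simp: K_def divide_simps)
  have [measurable]: "K \<in> borel_measurable borel"
    using cK by (auto intro: borel_measurable_continuous_onI)
  define l where "l k = 1 + 1 / real (Suc k)" for k
  have l: "l k > 1" for k by (simp add: l_def)
  define a where "a k = real (Suc k) * (l k ^ n - 1)" for k
  have a_pos: "a k \<ge> 0" for k using l[of k] by (simp add: a_def)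
  have at0: "filterlim (\<lambda>k. 1 / real (Suc k)) (at 0) sequentially"
    unfolding filterlim_at using LIMSEQ_inverse_real_of_nat by (simp add: inverse_eq_divide)
  have l_lim: "l \<longlonglongrightarrow> 1"
    unfolding l_def using tendsto_add[OF tendsto_const LIMSEQ_inverse_real_of_nat, of 1] by (simp add: inverse_eq_divide)
  have a_lim: "a \<longlonglongrightarrow> real n"
  proof -
    have "((\<lambda>t. (1 + t) ^ n) has_real_derivative real n) (at 0)"
      by (auto intro!: derivative_eq_intros)
    then have "((\<lambda>t. ((1 + t) ^ n - 1) / t) \<longlongrightarrow> real n) (at 0)"
      by (simp add: DERIV_def)
    from filterlim_compose[OF this at0] have "(\<lambda>k. a k) \<longlonglongrightarrow> real n"
      by (simp add: a_def l_def mult.commute)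
    then show ?thesis by simp
  qed
  obtain A where A: "\<And>k. \<bar>a k\<bar> \<le> A"
    using convergent_imp_Bseq[OF convergentI[OF a_lim]] by (auto simp: Bseq_def)
  obtain M where M: "M \<ge> 0" "\<And>x. norm (G x) \<le> M"
    using bounded_of_compact_support[OF cG zG] by metis
  obtain B where B: "B \<ge> 0" "\<And>x. norm (\<phi> x) \<le> B * indicator (cball 0 R) x"
    using bounded_of_compact_support[OF c z] by metis
  (* f and g are the difference quotients in the dilation factor l k, before and after moving
     the dilation to the kernel; they have the same integral. *)
  define f where "f k x = K x * (real (Suc k) * (\<phi> (l k *\<^sub>R x) - \<phi> x))" for k x
  define g where "g k y = real (Suc k) * (s / max (l k ^ n * s) (norm y ^ n) - s / max s (norm y ^ n)) * \<phi> y" for k y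
  have ray: "((\<lambda>t. \<phi> (t *\<^sub>R x)) has_real_derivative (G (u *\<^sub>R x) \<bullet> x)) (at u)" for x u
    unfolding has_field_derivative_def
    by (rule has_derivative_eq_rhs[OF has_derivative_compose[OF _ d, of "\<lambda>t. t *\<^sub>R x" "\<lambda>h. h *\<^sub>R x"]])
      (auto intro!: derivative_eq_intros simp: mult.commute)
  have f_lim: "(\<lambda>k. \<integral>x. f k x \<partial>lborel) \<longlonglongrightarrow> (\<integral>x. K x * (G x \<bullet> x) \<partial>lborel)"
  proof (rule integral_dominated_convergence)
    show "integrable lborel (\<lambda>x. (M * R) * indicator (cball (0::'a) R) x)"
      using emeasure_bounded_finite[OF bounded_cball[of "0::'a" R]] by simp
    show "AE x in lborel. (\<lambda>k. f k x) \<longlonglongrightarrow> K x * (G x \<bullet> x)"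
    proof (intro AE_I2)
      fix x
      have "((\<lambda>t. (\<phi> ((1 + t) *\<^sub>R x) - \<phi> x) / t) \<longlongrightarrow> G x \<bullet> x) (at 0)"
        using ray[of x 1] by (simp add: DERIV_def)
      from filterlim_compose[OF this at0]
      have "(\<lambda>k. real (Suc k) * (\<phi> (l k *\<^sub>R x) - \<phi> x)) \<longlonglongrightarrow> G x \<bullet> x"
        by (simp add: l_def mult.commute)
      then show "(\<lambda>k. f k x) \<longlonglongrightarrow> K x * (G x \<bullet> x)"
        unfolding f_def by (intro tendsto_intros)
    qed
    show "AE x in lborel. norm (f k x) \<le> (M * R) * indicator (cball (0::'a) R) x" for k
    proof (intro AE_I2)
      fix x
      show "norm (f k x) \<le> (M * R) * indicator (cball (0::'a) R) x"
      proof (cases "x \<in> cball 0 R")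
        case True
        obtain \<xi> where "\<phi> (l k *\<^sub>R x) - \<phi> (1 *\<^sub>R x) = (l k - 1) * (G (\<xi> *\<^sub>R x) \<bullet> x)"
          using MVT2[of 1 "l k" "\<lambda>t. \<phi> (t *\<^sub>R x)" "\<lambda>t. G (t *\<^sub>R x) \<bullet> x"] ray l by metis
        then have f: "f k x = K x * (G (\<xi> *\<^sub>R x) \<bullet> x)" by (simp add: f_def l_def)
        have "\<bar>G (\<xi> *\<^sub>R x) \<bullet> x\<bar> \<le> norm (G (\<xi> *\<^sub>R x)) * norm x"
          by (rule Cauchy_Schwarz_ineq2)
        also have "\<dots> \<le> M * R" using True M by (intro mult_mono) auto
        finally have "\<bar>K x\<bar> * \<bar>G (\<xi> *\<^sub>R x) \<bullet> x\<bar> \<le> 1 * (M * R)"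
          using K[of x] by (intro mult_mono) auto
        then show ?thesis using True f by (simp add: abs_mult)
      next
        case False
        have "norm x \<le> norm (l k *\<^sub>R x)" using l[of k] by (simp add: mult_le_cancel_right1)
        then show ?thesis using False z[of x] z[of "l k *\<^sub>R x"] by (simp add: f_def)
      qed
    qed
  qed (auto simp: f_def)
  have fg: "(\<integral>x. f k x \<partial>lborel) = (\<integral>x. g k x \<partial>lborel)" for k
  proof -
    have lk: "l k > 0" using l[of k] by simp
    have i1: "integrable lborel (\<lambda>x. K x * \<phi> (l k *\<^sub>R x))"
    proof (rule integrable_compact_support[of _ R])
      show "continuous_on UNIV (\<lambda>x. K x * \<phi> (l k *\<^sub>R x))"
        by (intro continuous_intros cK continuous_on_compose2[OF c]) auto
      show "K x * \<phi> (l k *\<^sub>R x) = 0" if "R < norm x" for x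
      proof -
        have "norm x \<le> norm (l k *\<^sub>R x)" using l[of k] by (simp add: mult_le_cancel_right1)
        then show ?thesis using that by (simp add: z)
      qed
    qed
    have i2: "integrable lborel (\<lambda>x. K x * \<phi> x)"
      by (rule integrable_compact_support[of _ R]) (auto intro!: continuous_intros cK c simp: z)
    let ?L = "\<lambda>y. s / max (l k ^ n * s) (norm y ^ n) * \<phi> y"
    have i3: "integrable lborel ?L"
    proof (rule integrable_compact_support[of _ R])
      have "max (l k ^ n * s) (norm y ^ n) \<noteq> 0" for y :: 'a
        using lk s by (metis less_irrefl max_less_iff_conj mult_pos_pos max.cobounded1 not_le zero_less_power)
      then show "continuous_on UNIV ?L" by (intro continuous_intros c) auto
    qed (simp add: z)
    have "(\<integral>y. ?L y \<partial>lborel) = l k ^ n * (\<integral>x. ?L (0 + l k *\<^sub>R x) \<partial>lborel)"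
      unfolding n_def by (rule lborel_integral_affine[OF lk]) simp
    also have "\<dots> = (\<integral>x. l k ^ n * ?L (l k *\<^sub>R x) \<partial>lborel)"
      unfolding add_0 by (rule integral_mult_right_zero[symmetric])
    also have "\<dots> = (\<integral>x. K x * \<phi> (l k *\<^sub>R x) \<partial>lborel)"
    proof (rule Bochner_Integration.integral_cong[OF refl])
      fix x :: 'a
      have "max (l k ^ n * s) (norm (l k *\<^sub>R x) ^ n) = l k ^ n * max s (norm x ^ n)"
        using lk by (simp add: power_mult_distrib max_mult_distrib_left)
      then show "l k ^ n * ?L (l k *\<^sub>R x) = K x * \<phi> (l k *\<^sub>R x)"
        using lk by (simp add: K_def)
    qed
    finally have e: "(\<integral>x. K x * \<phi> (l k *\<^sub>R x) \<partial>lborel) = (\<integral>y. ?L y \<partial>lborel)" by simp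
    have "(\<integral>x. f k x \<partial>lborel) = (\<integral>x. real (Suc k) * (K x * \<phi> (l k *\<^sub>R x) - K x * \<phi> x) \<partial>lborel)"
      by (rule Bochner_Integration.integral_cong) (auto simp: f_def algebra_simps)
    also have "\<dots> = real (Suc k) * ((\<integral>y. ?L y \<partial>lborel) - (\<integral>x. K x * \<phi> x \<partial>lborel))"
      using i1 i2 e by simp
    also have "\<dots> = (\<integral>x. real (Suc k) * (?L x - K x * \<phi> x) \<partial>lborel)"
      using i2 i3 by simp
    also have "\<dots> = (\<integral>x. g k x \<partial>lborel)"
      by (rule Bochner_Integration.integral_cong) (auto simp: g_def K_def algebra_simps)
    finally show ?thesis .
  qed
  have g_lim: "(\<lambda>k. \<integral>x. g k x \<partial>lborel) \<longlonglongrightarrow> (\<integral>x. - real n * (indicator {x. norm x ^ n < s} x * \<phi> x) \<partial>lborel)"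
  proof (rule integral_dominated_convergence)
    show "integrable lborel (\<lambda>x. A * (B * indicator (cball (0::'a) R) x))"
      using emeasure_bounded_finite[OF bounded_cball[of "0::'a" R]] by simp
    have "AE x in lborel. norm (x::'a) \<noteq> root n s" by (rule AE_norm_neq)
    then show "AE x in lborel. (\<lambda>k. g k x) \<longlonglongrightarrow> - real n * (indicator {x. norm x ^ n < s} x * \<phi> x)"
    proof (rule AE_mp, intro AE_I2 impI)
      fix x :: 'a assume "norm x \<noteq> root n s"
      then have "norm x ^ n \<noteq> s"
        using n real_root_power_cancel[of n "norm x"] by auto
      then consider "norm x ^ n < s" | "norm x ^ n > s" by linarith
      then show "(\<lambda>k. g k x) \<longlonglongrightarrow> - real n * (indicator {x. norm x ^ n < s} x * \<phi> x)"
      proof cases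
        case 1
        have "g k x = - (a k / l k ^ n) * \<phi> x" for k
        proof -
          have "s \<le> l k ^ n * s" using s l[of k] by (simp add: mult_le_cancel_right1)
          then have "max (l k ^ n * s) (norm x ^ n) = l k ^ n * s" "max s (norm x ^ n) = s" using 1 by auto
          then show ?thesis using s l[of k] by (simp add: g_def a_def field_simps)
        qed
        moreover have "(\<lambda>k. - (a k / l k ^ n) * \<phi> x) \<longlonglongrightarrow> - (real n / 1 ^ n) * \<phi> x"
          by (intro tendsto_intros a_lim l_lim) auto
        ultimately show ?thesis using 1 by simp
      next
        case 2
        have "(\<lambda>k. l k ^ n * s) \<longlonglongrightarrow> 1 ^ n * s" by (intro tendsto_intros l_lim)
        then have "\<forall>\<^sub>F k in sequentially. l k ^ n * s < norm x ^ n"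
          using 2 by (intro order_tendstoD) auto
        then have "\<forall>\<^sub>F k in sequentially. g k x = 0"
          by (rule eventually_mono) (use 2 in \<open>simp add: g_def max_def\<close>)
        then have "(\<lambda>k. g k x) \<longlonglongrightarrow> 0" by (rule tendsto_eventually)
        then show ?thesis using 2 by simp
      qed
    qed
    show "AE x in lborel. norm (g k x) \<le> A * (B * indicator (cball (0::'a) R) x)" for k
    proof (intro AE_I2)
      fix x :: 'a
      let ?c = "norm x ^ n"
      define p where "p = max (l k ^ n * s) ?c"
      define q where "q = max s ?c"
      have ls: "s \<le> l k ^ n * s" using s l[of k] by (simp add: mult_le_cancel_right1)
      then have pq: "s \<le> q" "q \<le> p" "p - q \<le> l k ^ n * s - s" by (auto simp: p_def q_def)
      have "s / q - s / p = s / p * ((p - q) / q)" using s pq by (simp add: field_simps)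
      also have "\<dots> \<le> 1 * ((l k ^ n * s - s) / s)"
        using s pq ls by (intro mult_mono frac_le divide_nonneg_pos) auto
      also have "\<dots> = l k ^ n - 1" using s by (simp add: field_simps)
      finally have 1: "s / q - s / p \<le> l k ^ n - 1" .
      have 2: "s / p \<le> s / q" using s pq by (intro divide_left_mono) auto
      have "\<bar>real (Suc k) * (s / p - s / q)\<bar> = real (Suc k) * (s / q - s / p)"
        using 2 by (simp add: abs_mult)
      also have "\<dots> \<le> a k" unfolding a_def by (intro mult_left_mono 1) simp
      also have "\<dots> \<le> A" using A[of k] by simp
      finally have "\<bar>real (Suc k) * (s / p - s / q)\<bar> * \<bar>\<phi> x\<bar> \<le> A * (B * indicator (cball (0::'a) R) x)"
        using B(2)[of x] A[of k] by (intro mult_mono) auto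
      then show "norm (g k x) \<le> A * (B * indicator (cball (0::'a) R) x)"
        by (simp add: g_def p_def q_def abs_mult)
    qed
  qed (auto simp: g_def)
  have "(\<integral>x. K x * (G x \<bullet> x) \<partial>lborel) = (\<integral>x. - real n * (indicator {x. norm x ^ n < s} x * \<phi> x) \<partial>lborel)"
    using f_lim g_lim LIMSEQ_unique unfolding fg by blast
  then show ?thesis unfolding K_def n_def by simp
qed

section \<open>Weak solutions on bounded domains\<close>

lemma directional_derivative:
  assumes "(f has_derivative (\<lambda>v. g \<bullet> v)) (at x)"
  shows "((\<lambda>t. f (x + t *\<^sub>R b)) has_real_derivative (g \<bullet> b)) (at 0)"
proof -
  have line: "((\<lambda>t. x + t *\<^sub>R b) has_derivative (\<lambda>h. h *\<^sub>R b)) (at 0)"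
    by (auto intro!: derivative_eq_intros)
  have "((\<lambda>t. f (x + t *\<^sub>R b)) has_derivative (\<lambda>h. g \<bullet> (h *\<^sub>R b))) (at 0)"
    using has_derivative_compose[OF line, of f "\<lambda>v. g \<bullet> v"] assms by simp
  then show ?thesis
    unfolding has_field_derivative_def by (rule has_derivative_eq_rhs) (auto simp: mult.commute)
qed

lemma gradient_continuous:
  assumes "C_k (Suc k) f" shows "continuous_on UNIV (gradient f)"
proof -
  have "continuous_on UNIV (partial_deriv f i)" if "i \<in> Basis" for i
    using assms that C_k_continuous by auto
  then show ?thesis unfolding gradient_def[abs_def] by (auto intro!: continuous_intros)
qed

lemma test_functionD:
  assumes "\<phi> \<in> test_functions \<Omega>"
  shows "C_k k \<phi>" and "\<phi> differentiable (at x)"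
    and "continuous_on UNIV \<phi>" and "continuous_on UNIV (gradient \<phi>)"
    and "x \<notin> \<Omega> \<Longrightarrow> \<phi> x = 0" and "x \<notin> \<Omega> \<Longrightarrow> gradient \<phi> x = 0"
proof -
  have C: "C_k k \<phi>" for k using assms by (simp add: test_functions_def)
  then show "C_k k \<phi>" .
  show "\<phi> differentiable (at x)" using C[of 1] by simp
  show "continuous_on UNIV \<phi>" using C[of 0] by simp
  show "continuous_on UNIV (gradient \<phi>)" using gradient_continuous C by blast
  have sub: "closure {x. \<phi> x \<noteq> 0} \<subseteq> \<Omega>" using assms by (simp add: test_functions_def)
  show "\<phi> x = 0" if "x \<notin> \<Omega>"
    using that order_trans[OF closure_subset sub] by auto
  show "gradient \<phi> x = 0" if "x \<notin> \<Omega>"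
  proof -
    have "\<forall>\<^sub>F y in nhds x. y \<in> - closure {x. \<phi> x \<noteq> 0}"
      using that sub by (intro eventually_nhds_in_open) auto
    then have "\<forall>\<^sub>F y in nhds x. 0 = \<phi> y"
      by (rule eventually_mono) (use closure_subset[of "{x. \<phi> x \<noteq> 0}"] in auto)
    moreover have "((\<lambda>_. 0) has_derivative (\<lambda>v. 0 \<bullet> v)) (at x)" by simp
    ultimately have "(\<phi> has_derivative (\<lambda>v. 0 \<bullet> v)) (at x)"
      by (intro has_derivative_transform_eventually[of "\<lambda>_. 0" _ x UNIV \<phi>])
        (auto simp: eventually_nhds_conv_at)
    then show ?thesis by (rule gradient_eqI)
  qed
qed

lemma gradient_diff:
  assumes "f differentiable (at x)" "g differentiable (at x)"
  shows "gradient (\<lambda>x. f x - g x) x = gradient f x - gradient g x"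
  by (rule gradient_eqI)
    (use has_derivative_diff[OF assms[THEN has_derivative_gradient]] in \<open>simp add: inner_diff_left\<close>)

lemma test_functions_diff:
  assumes "\<phi> \<in> test_functions \<Omega>" "\<psi> \<in> test_functions \<Omega>"
  shows "(\<lambda>x. \<phi> x - \<psi> x) \<in> test_functions \<Omega>"
proof -
  let ?S = "closure {x. \<phi> x \<noteq> 0} \<union> closure {x. \<psi> x \<noteq> 0}"
  have "closure {x. \<phi> x - \<psi> x \<noteq> 0} \<subseteq> closure ({x. \<phi> x \<noteq> 0} \<union> {x. \<psi> x \<noteq> 0})"
    by (intro closure_mono) auto
  then have sub: "closure {x. \<phi> x - \<psi> x \<noteq> 0} \<subseteq> ?S" by simp
  have S: "compact ?S" "?S \<subseteq> \<Omega>" using assms by (auto simp: test_functions_def compact_Un)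
  then have "bounded (closure {x. \<phi> x - \<psi> x \<noteq> 0})"
    using sub compact_imp_bounded bounded_subset by blast
  then have "compact (closure {x. \<phi> x - \<psi> x \<noteq> 0})"
    by (simp add: compact_eq_bounded_closed)
  moreover have "C_k k (\<lambda>x. \<phi> x + (- 1) * \<psi> x)" for k
    by (intro C_k_add C_k_mult C_k_const test_functionD(1)[OF assms(1)] test_functionD(1)[OF assms(2)])
  then have "C_k k (\<lambda>x. \<phi> x - \<psi> x)" for k by simp
  ultimately show ?thesis
    unfolding test_functions_def using order_trans[OF sub S(2)] by simp
qed

lemma integral_lebesgue_on_borel:
  fixes f :: "'a::euclidean_space \<Rightarrow> real"
  assumes "\<Omega> \<in> sets borel" "f \<in> borel_measurable borel"
  shows "(\<integral>x. f x \<partial>lebesgue_on \<Omega>) = (\<integral>x. indicator \<Omega> x * f x \<partial>lborel)"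
proof -
  have "(\<integral>x. f x \<partial>lebesgue_on \<Omega>) = (\<integral>x. indicator \<Omega> x * f x \<partial>lebesgue)"
    using assms by (subst integral_restrict_space) auto
  also have "\<dots> = (\<integral>x. indicator \<Omega> x * f x \<partial>lborel)"
    using assms by (intro integral_completion) auto
  finally show ?thesis .
qed

lemma integral_lebesgue_on_vanishing:
  fixes f :: "'a::euclidean_space \<Rightarrow> real"
  assumes "\<Omega> \<in> sets borel" "f \<in> borel_measurable borel" "\<And>x. x \<notin> \<Omega> \<Longrightarrow> f x = 0"
  shows "(\<integral>x. f x \<partial>lebesgue_on \<Omega>) = (\<integral>x. f x \<partial>lborel)"
  unfolding integral_lebesgue_on_borel[OF assms(1,2)]
  using assms(3) by (intro Bochner_Integration.integral_cong) (auto simp: indicator_def)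

lemma borel_measurable_lebesgue_on:
  "f \<in> borel_measurable borel \<Longrightarrow> f \<in> borel_measurable (lebesgue_on \<Omega>)"
  by (rule measurable_restrict_space1) (rule measurable_completion, simp)

lemma emeasure_lebesgue_on_finite:
  assumes "\<Omega> \<in> sets borel" "bounded (\<Omega>::'a::euclidean_space set)"
  shows "emeasure (lebesgue_on \<Omega>) (space (lebesgue_on \<Omega>)) < \<infinity>"
proof -
  have "emeasure (lebesgue_on \<Omega>) (space (lebesgue_on \<Omega>)) = emeasure lborel \<Omega>"
    using assms(1) by (simp add: emeasure_restrict_space)
  also have "\<dots> < \<infinity>" using assms(2) by (rule emeasure_bounded_finite)
  finally show ?thesis .
qed

lemma integrable_lebesgue_on_bounded:
  fixes f :: "'a::euclidean_space \<Rightarrow> real"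
  assumes "\<Omega> \<in> sets borel" "bounded \<Omega>" "f \<in> borel_measurable (lebesgue_on \<Omega>)"
    and "\<And>x. x \<in> \<Omega> \<Longrightarrow> \<bar>f x\<bar> \<le> B"
  shows "integrable (lebesgue_on \<Omega>) f"
proof (rule Bochner_Integration.integrable_bound)
  show "integrable (lebesgue_on \<Omega>) (\<lambda>x. B)"
    by (rule finite_measure.integrable_const[OF finite_measureI])
      (use emeasure_lebesgue_on_finite[OF assms(1,2)] in auto)
  show "AE x in lebesgue_on \<Omega>. norm (f x) \<le> norm B"
    by (intro AE_I2) (use assms(4) in force)
qed (use assms in auto)

lemma L2_on_bounded:
  fixes f :: "'a::euclidean_space \<Rightarrow> 'b::euclidean_space"
  assumes "\<Omega> \<in> sets borel" "bounded \<Omega>" "f \<in> borel_measurable (lebesgue_on \<Omega>)"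
    and "\<And>x. x \<in> \<Omega> \<Longrightarrow> norm (f x) \<le> B"
  shows "L2_on \<Omega> f"
  unfolding L2_on_def
proof
  have [measurable]: "f \<in> borel_measurable (lebesgue_on \<Omega>)" by fact
  show "integrable (lebesgue_on \<Omega>) (\<lambda>x. (norm (f x))\<^sup>2)"
    by (rule integrable_lebesgue_on_bounded[OF assms(1,2), of _ "B\<^sup>2"])
      (use assms(4) in \<open>auto intro!: power_mono\<close>)
qed fact

lemma L2_on_inner:
  assumes "L2_on \<Omega> f" "L2_on \<Omega> g"
  shows "integrable (lebesgue_on \<Omega>) (\<lambda>x. f x \<bullet> g x)"
proof (rule Bochner_Integration.integrable_bound)
  have [measurable]: "f \<in> borel_measurable (lebesgue_on \<Omega>)" "g \<in> borel_measurable (lebesgue_on \<Omega>)"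
    using assms by (auto simp: L2_on_def)
  show "integrable (lebesgue_on \<Omega>) (\<lambda>x. (norm (f x))\<^sup>2 + (norm (g x))\<^sup>2)"
    using assms by (auto simp: L2_on_def)
  show "AE x in lebesgue_on \<Omega>. norm (f x \<bullet> g x) \<le> norm ((norm (f x))\<^sup>2 + (norm (g x))\<^sup>2)"
  proof (intro AE_I2)
    fix x
    have "\<bar>f x \<bullet> g x\<bar> \<le> norm (f x) * norm (g x)" by (rule Cauchy_Schwarz_ineq2)
    moreover have "0 \<le> (norm (f x) - norm (g x))\<^sup>2" "0 \<le> norm (f x) * norm (g x)" by auto
    ultimately have "\<bar>f x \<bullet> g x\<bar> \<le> (norm (f x))\<^sup>2 + (norm (g x))\<^sup>2"
      by (simp add: power2_diff)
    then show "norm (f x \<bullet> g x) \<le> norm ((norm (f x))\<^sup>2 + (norm (g x))\<^sup>2)" by simp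
  qed
  show "(\<lambda>x. f x \<bullet> g x) \<in> borel_measurable (lebesgue_on \<Omega>)" by simp
qed

lemma L2_on_scale_add:
  assumes "L2_on \<Omega> f" "L2_on \<Omega> g"
  shows "L2_on \<Omega> (\<lambda>x. c *\<^sub>R f x + g x)"
proof -
  have "integrable (lebesgue_on \<Omega>) (\<lambda>x. c\<^sup>2 * (norm (f x))\<^sup>2 + 2 * c * (f x \<bullet> g x) + (norm (g x))\<^sup>2)"
    using assms L2_on_inner[OF assms] by (auto simp: L2_on_def)
  moreover have "(norm (c *\<^sub>R f x + g x))\<^sup>2 = c\<^sup>2 * (norm (f x))\<^sup>2 + 2 * c * (f x \<bullet> g x) + (norm (g x))\<^sup>2" for x
    unfolding power2_norm_eq_inner by (simp add: algebra_simps inner_commute power2_eq_square)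
  ultimately show ?thesis using assms by (auto simp: L2_on_def)
qed

lemma L2_on_diff: "L2_on \<Omega> f \<Longrightarrow> L2_on \<Omega> g \<Longrightarrow> L2_on \<Omega> (\<lambda>x. f x - g x)"
  using L2_on_scale_add[of \<Omega> g f "-1"] by simp

text \<open>The quadratic polynomial \<open>t \<mapsto> \<parallel>t f + g\<parallel>\<^sup>2\<close> is nonnegative, so its discriminant is not positive.\<close>
lemma L2_on_Cauchy_Schwarz:
  assumes f: "L2_on \<Omega> f" and g: "L2_on \<Omega> g"
  shows "(\<integral>x. f x \<bullet> g x \<partial>lebesgue_on \<Omega>)\<^sup>2
           \<le> (\<integral>x. (norm (f x))\<^sup>2 \<partial>lebesgue_on \<Omega>) * (\<integral>x. (norm (g x))\<^sup>2 \<partial>lebesgue_on \<Omega>)"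
proof -
  define A where "A = (\<integral>x. (norm (f x))\<^sup>2 \<partial>lebesgue_on \<Omega>)"
  define B where "B = (\<integral>x. (norm (g x))\<^sup>2 \<partial>lebesgue_on \<Omega>)"
  define c where "c = (\<integral>x. f x \<bullet> g x \<partial>lebesgue_on \<Omega>)"
  have q: "0 \<le> A * t\<^sup>2 + 2 * t * c + B" for t
  proof -
    have i: "integrable (lebesgue_on \<Omega>) (\<lambda>x. (norm (f x))\<^sup>2)" "integrable (lebesgue_on \<Omega>) (\<lambda>x. (norm (g x))\<^sup>2)"
      using f g by (auto simp: L2_on_def)
    have "0 \<le> (\<integral>x. (norm (t *\<^sub>R f x + g x))\<^sup>2 \<partial>lebesgue_on \<Omega>)" by simp
    also have "\<dots> = (\<integral>x. t\<^sup>2 * (norm (f x))\<^sup>2 + 2 * t * (f x \<bullet> g x) + (norm (g x))\<^sup>2 \<partial>lebesgue_on \<Omega>)"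
      by (intro Bochner_Integration.integral_cong refl)
        (simp only: power2_norm_eq_inner, simp add: algebra_simps inner_commute power2_eq_square)
    also have "\<dots> = A * t\<^sup>2 + 2 * t * c + B"
      using i L2_on_inner[OF f g] by (simp add: A_def B_def c_def)
    finally show ?thesis .
  qed
  have A: "A \<ge> 0" by (simp add: A_def)
  have "c\<^sup>2 \<le> A * B"
  proof (cases "A = 0")
    case True
    have "c = 0"
    proof (rule ccontr)
      assume "c \<noteq> 0"
      then show False using q[of "- (B + 1) / (2 * c)"] True by (simp add: field_simps)
    qed
    then show ?thesis using True by simp
  next
    case False
    have "A * (A * (- c / A)\<^sup>2 + 2 * (- c / A) * c + B) = A * B - c\<^sup>2"
      using False by (simp add: field_simps power2_eq_square)
    moreover have "0 \<le> A * (A * (- c / A)\<^sup>2 + 2 * (- c / A) * c + B)"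
      using q A by (intro mult_nonneg_nonneg)
    ultimately show ?thesis by simp
  qed
  then show ?thesis by (simp add: A_def B_def c_def)
qed

lemma L2_on_weak_limit:
  assumes "L2_on \<Omega> f" "L2_on \<Omega> g" "\<And>k. L2_on \<Omega> (h k)"
    and "(\<lambda>k. \<integral>x. (norm (h k x - g x))\<^sup>2 \<partial>lebesgue_on \<Omega>) \<longlonglongrightarrow> 0"
  shows "(\<lambda>k. \<integral>x. f x \<bullet> h k x \<partial>lebesgue_on \<Omega>) \<longlonglongrightarrow> (\<integral>x. f x \<bullet> g x \<partial>lebesgue_on \<Omega>)"
proof -
  let ?A = "\<integral>x. (norm (f x))\<^sup>2 \<partial>lebesgue_on \<Omega>"
  let ?d = "\<lambda>k. \<integral>x. f x \<bullet> (h k x - g x) \<partial>lebesgue_on \<Omega>"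
  have "(\<lambda>k. (?d k)\<^sup>2) \<longlonglongrightarrow> 0"
  proof (rule tendsto_sandwich[OF _ _ tendsto_const])
    show "(\<lambda>k. ?A * (\<integral>x. (norm (h k x - g x))\<^sup>2 \<partial>lebesgue_on \<Omega>)) \<longlonglongrightarrow> 0"
      using tendsto_mult[OF tendsto_const assms(4), of ?A] by simp
  qed (use L2_on_Cauchy_Schwarz[OF assms(1) L2_on_diff[OF assms(3,2)]] in auto)
  from tendsto_real_sqrt[OF this] have "?d \<longlonglongrightarrow> 0"
    by (simp add: tendsto_rabs_zero_iff)
  moreover have "?d k = (\<integral>x. f x \<bullet> h k x \<partial>lebesgue_on \<Omega>) - (\<integral>x. f x \<bullet> g x \<partial>lebesgue_on \<Omega>)" for k
    using L2_on_inner[OF assms(1,2)] L2_on_inner[OF assms(1,3)] by (simp add: inner_diff_right)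
  ultimately show ?thesis by (simp add: LIM_zero_iff)
qed

locale bounded_domain =
  fixes \<Omega> :: "'a::euclidean_space set" and R :: real
  assumes borel_dom: "\<Omega> \<in> sets borel" and dom_subset: "\<Omega> \<subseteq> cball 0 R"
begin

lemma bounded_dom: "bounded \<Omega>"
  using bounded_cball bounded_subset dom_subset by blast

lemma test_function_vanishes:
  assumes "\<phi> \<in> test_functions \<Omega>" "norm x > R"
  shows "\<phi> x = 0" "gradient \<phi> x = 0"
  using assms test_functionD(5,6)[OF assms(1), of x] dom_subset by force+

lemma test_function_L2:
  assumes "\<phi> \<in> test_functions \<Omega>"
  shows "L2_on \<Omega> \<phi>" "L2_on \<Omega> (gradient \<phi>)"
proof -
  note D = test_functionD(3,4)[OF assms]
  obtain B where "\<And>x. norm (\<phi> x) \<le> B"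
    using bounded_of_compact_support[OF D(1) test_function_vanishes(1)[OF assms]] by metis
  then show "L2_on \<Omega> \<phi>"
    using D by (intro L2_on_bounded[OF borel_dom bounded_dom] borel_measurable_lebesgue_on borel_measurable_continuous_onI)
  obtain B where "\<And>x. norm (gradient \<phi> x) \<le> B"
    using bounded_of_compact_support[OF D(2) test_function_vanishes(2)[OF assms]] by metis
  then show "L2_on \<Omega> (gradient \<phi>)"
    using D by (intro L2_on_bounded[OF borel_dom bounded_dom] borel_measurable_lebesgue_on borel_measurable_continuous_onI)
qed

lemma H10_approx:
  assumes "has_H10_gradient \<Omega> u g"
  shows "\<exists>\<phi>. (\<forall>k::nat. \<phi> k \<in> test_functions \<Omega>) \<and>
    (\<lambda>k. \<integral>x. (norm (\<phi> k x - u x))\<^sup>2 \<partial>lebesgue_on \<Omega>) \<longlonglongrightarrow> 0 \<and>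
    (\<lambda>k. \<integral>x. (norm (gradient (\<phi> k) x - g x))\<^sup>2 \<partial>lebesgue_on \<Omega>) \<longlonglongrightarrow> 0"
proof -
  obtain \<phi> where \<phi>: "\<forall>k::nat. \<phi> k \<in> test_functions \<Omega>"
    and l: "(\<lambda>k. (\<integral>x. (\<phi> k x - u x)\<^sup>2 \<partial>lebesgue_on \<Omega>)
                 + (\<integral>x. (norm (gradient (\<phi> k) x - g x))\<^sup>2 \<partial>lebesgue_on \<Omega>)) \<longlonglongrightarrow> 0"
    using assms unfolding has_H10_gradient_def by blast
  have "(\<lambda>k. \<integral>x. (norm (\<phi> k x - u x))\<^sup>2 \<partial>lebesgue_on \<Omega>) \<longlonglongrightarrow> 0"
    by (rule tendsto_sandwich[OF _ _ tendsto_const l]) (auto intro!: always_eventually)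
  moreover have "(\<lambda>k. \<integral>x. (norm (gradient (\<phi> k) x - g x))\<^sup>2 \<partial>lebesgue_on \<Omega>) \<longlonglongrightarrow> 0"
    by (rule tendsto_sandwich[OF _ _ tendsto_const l]) (auto intro!: always_eventually)
  ultimately show ?thesis using \<phi> by blast
qed

lemma H10_L2:
  assumes "has_H10_gradient \<Omega> u g" shows "L2_on \<Omega> u" "L2_on \<Omega> g"
  using assms by (auto simp: has_H10_gradient_def has_H1_gradient_def)

text \<open>Both sides of the weak equation are continuous for the \<open>H\<^sup>1\<close> norm, and test functions are dense
  in \<open>H\<^sup>1\<^sub>0\<close> by definition.\<close>
lemma weak_solution_from_test_functions:
  assumes H: "has_H10_gradient \<Omega> u g" and f: "L2_on \<Omega> f"
    and test: "\<And>\<phi>. \<phi> \<in> test_functions \<Omega> \<Longrightarrow>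
       (\<integral>x. g x \<bullet> gradient \<phi> x \<partial>lebesgue_on \<Omega>) = (\<integral>x. f x * \<phi> x \<partial>lebesgue_on \<Omega>)"
  shows "weak_Dirichlet_solution \<Omega> f u"
  unfolding weak_Dirichlet_solution_def
proof (intro exI conjI allI impI)
  show "has_H10_gradient \<Omega> u g" by fact
  fix v h assume v: "has_H10_gradient \<Omega> v h"
  obtain \<phi> where \<phi>: "\<And>k::nat. \<phi> k \<in> test_functions \<Omega>"
    "(\<lambda>k. \<integral>x. (norm (\<phi> k x - v x))\<^sup>2 \<partial>lebesgue_on \<Omega>) \<longlonglongrightarrow> 0"
    "(\<lambda>k. \<integral>x. (norm (gradient (\<phi> k) x - h x))\<^sup>2 \<partial>lebesgue_on \<Omega>) \<longlonglongrightarrow> 0"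
    using H10_approx[OF v] by blast
  have "(\<lambda>k. \<integral>x. g x \<bullet> gradient (\<phi> k) x \<partial>lebesgue_on \<Omega>) \<longlonglongrightarrow> (\<integral>x. g x \<bullet> h x \<partial>lebesgue_on \<Omega>)"
    by (rule L2_on_weak_limit[OF H10_L2(2)[OF H] H10_L2(2)[OF v] test_function_L2(2)[OF \<phi>(1)] \<phi>(3)])
  moreover have "(\<lambda>k. \<integral>x. f x \<bullet> \<phi> k x \<partial>lebesgue_on \<Omega>) \<longlonglongrightarrow> (\<integral>x. f x \<bullet> v x \<partial>lebesgue_on \<Omega>)"
    by (rule L2_on_weak_limit[OF f H10_L2(1)[OF v] test_function_L2(1)[OF \<phi>(1)] \<phi>(2)])
  ultimately show "(\<integral>x. g x \<bullet> h x \<partial>lebesgue_on \<Omega>) = (\<integral>x. f x * v x \<partial>lebesgue_on \<Omega>)"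
    using LIMSEQ_unique by (simp add: test[OF \<phi>(1)] inner_real_def)
qed

lemma L2_diff_limit:
  assumes "\<And>k. L2_on \<Omega> (a k)" "\<And>k. L2_on \<Omega> (b k)"
    and "(\<lambda>k. \<integral>x. (norm (a k x))\<^sup>2 \<partial>lebesgue_on \<Omega>) \<longlonglongrightarrow> 0"
    and "(\<lambda>k. \<integral>x. (norm (b k x))\<^sup>2 \<partial>lebesgue_on \<Omega>) \<longlonglongrightarrow> 0"
  shows "(\<lambda>k. \<integral>x. (norm (a k x - b k x))\<^sup>2 \<partial>lebesgue_on \<Omega>) \<longlonglongrightarrow> 0"
proof (rule tendsto_sandwich[OF _ _ tendsto_const])
  show "(\<lambda>k. 2 * (\<integral>x. (norm (a k x))\<^sup>2 \<partial>lebesgue_on \<Omega>) + 2 * (\<integral>x. (norm (b k x))\<^sup>2 \<partial>lebesgue_on \<Omega>)) \<longlonglongrightarrow> 0"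
    using tendsto_add[OF tendsto_mult[OF tendsto_const assms(3)] tendsto_mult[OF tendsto_const assms(4)], of 2 2] by simp
  have i: "integrable (lebesgue_on \<Omega>) (\<lambda>x. (norm (a k x))\<^sup>2)" "integrable (lebesgue_on \<Omega>) (\<lambda>x. (norm (b k x))\<^sup>2)"
    "integrable (lebesgue_on \<Omega>) (\<lambda>x. (norm (a k x - b k x))\<^sup>2)" for k
    using assms(1,2) L2_on_diff[OF assms(1,2)] by (auto simp: L2_on_def)
  have p: "(norm (v - w))\<^sup>2 \<le> 2 * (norm v)\<^sup>2 + 2 * (norm w)\<^sup>2" for v w :: 'b
  proof -
    have "0 \<le> (v + w) \<bullet> (v + w)" by simp
    then show ?thesis unfolding power2_norm_eq_inner by (simp add: algebra_simps inner_commute)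
  qed
  have "(\<integral>x. (norm (a k x - b k x))\<^sup>2 \<partial>lebesgue_on \<Omega>)
        \<le> (\<integral>x. 2 * (norm (a k x))\<^sup>2 + 2 * (norm (b k x))\<^sup>2 \<partial>lebesgue_on \<Omega>)" for k
    using i p by (intro integral_mono) auto
  then show "\<forall>\<^sub>F k in sequentially. (\<integral>x. (norm (a k x - b k x))\<^sup>2 \<partial>lebesgue_on \<Omega>)
      \<le> 2 * (\<integral>x. (norm (a k x))\<^sup>2 \<partial>lebesgue_on \<Omega>) + 2 * (\<integral>x. (norm (b k x))\<^sup>2 \<partial>lebesgue_on \<Omega>)"
    using i by (auto intro!: always_eventually)
qed simp

lemma H10_diff:
  assumes u: "has_H10_gradient \<Omega> u g" and v: "has_H10_gradient \<Omega> v h"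
  shows "has_H10_gradient \<Omega> (\<lambda>x. u x - v x) (\<lambda>x. g x - h x)"
  unfolding has_H10_gradient_def has_H1_gradient_def
proof (intro conjI ballI)
  show "L2_on \<Omega> (\<lambda>x. u x - v x)" "L2_on \<Omega> (\<lambda>x. g x - h x)"
    using H10_L2[OF u] H10_L2[OF v] by (auto intro: L2_on_diff)
  show "(\<integral>x. (u x - v x) * partial_deriv \<phi> i x \<partial>lebesgue_on \<Omega>)
          = - (\<integral>x. ((g x - h x) \<bullet> i) * \<phi> x \<partial>lebesgue_on \<Omega>)"
    if \<phi>: "\<phi> \<in> test_functions \<Omega>" and i: "i \<in> Basis" for \<phi> i
  proof -
    have L: "L2_on \<Omega> \<phi>" "L2_on \<Omega> (gradient \<phi>)" by (rule test_function_L2[OF \<phi>])+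
    have c: "L2_on \<Omega> (\<lambda>x. w x \<bullet> i)" if "L2_on \<Omega> w" for w :: "'a \<Rightarrow> 'a"
      unfolding L2_on_def
    proof
      have [measurable]: "w \<in> borel_measurable (lebesgue_on \<Omega>)" using that by (simp add: L2_on_def)
      show "(\<lambda>x. w x \<bullet> i) \<in> borel_measurable (lebesgue_on \<Omega>)" by simp
      show "integrable (lebesgue_on \<Omega>) (\<lambda>x. (norm (w x \<bullet> i))\<^sup>2)"
      proof (rule Bochner_Integration.integrable_bound)
        show "integrable (lebesgue_on \<Omega>) (\<lambda>x. (norm (w x))\<^sup>2)" using that by (simp add: L2_on_def)
        show "AE x in lebesgue_on \<Omega>. norm ((norm (w x \<bullet> i))\<^sup>2) \<le> norm ((norm (w x))\<^sup>2)"
          using Basis_le_norm[OF i] by (intro AE_I2) (auto intro!: power_mono simp: abs_le_square_iff[symmetric])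
      qed simp
    qed
    have p: "L2_on \<Omega> (partial_deriv \<phi> i)"
      using c[OF L(2)] i by (simp add: gradient_inner_Basis)
    have I: "integrable (lebesgue_on \<Omega>) (\<lambda>x. u x * partial_deriv \<phi> i x)"
      "integrable (lebesgue_on \<Omega>) (\<lambda>x. v x * partial_deriv \<phi> i x)"
      "integrable (lebesgue_on \<Omega>) (\<lambda>x. (g x \<bullet> i) * \<phi> x)" "integrable (lebesgue_on \<Omega>) (\<lambda>x. (h x \<bullet> i) * \<phi> x)"
      using L2_on_inner[OF H10_L2(1)[OF u] p] L2_on_inner[OF H10_L2(1)[OF v] p]
        L2_on_inner[OF c[OF H10_L2(2)[OF u]] L(1)] L2_on_inner[OF c[OF H10_L2(2)[OF v]] L(1)]
      by (simp_all add: inner_real_def)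
    have "(\<integral>x. u x * partial_deriv \<phi> i x \<partial>lebesgue_on \<Omega>) = - (\<integral>x. (g x \<bullet> i) * \<phi> x \<partial>lebesgue_on \<Omega>)"
      "(\<integral>x. v x * partial_deriv \<phi> i x \<partial>lebesgue_on \<Omega>) = - (\<integral>x. (h x \<bullet> i) * \<phi> x \<partial>lebesgue_on \<Omega>)"
      using u v \<phi> i by (auto simp: has_H10_gradient_def has_H1_gradient_def)
    then show ?thesis using I by (simp add: left_diff_distrib inner_diff_left)
  qed
  obtain \<phi> where \<phi>: "\<And>k::nat. \<phi> k \<in> test_functions \<Omega>"
    "(\<lambda>k. \<integral>x. (norm (\<phi> k x - u x))\<^sup>2 \<partial>lebesgue_on \<Omega>) \<longlonglongrightarrow> 0"
    "(\<lambda>k. \<integral>x. (norm (gradient (\<phi> k) x - g x))\<^sup>2 \<partial>lebesgue_on \<Omega>) \<longlonglongrightarrow> 0"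
    using H10_approx[OF u] by blast
  obtain \<psi> where \<psi>: "\<And>k::nat. \<psi> k \<in> test_functions \<Omega>"
    "(\<lambda>k. \<integral>x. (norm (\<psi> k x - v x))\<^sup>2 \<partial>lebesgue_on \<Omega>) \<longlonglongrightarrow> 0"
    "(\<lambda>k. \<integral>x. (norm (gradient (\<psi> k) x - h x))\<^sup>2 \<partial>lebesgue_on \<Omega>) \<longlonglongrightarrow> 0"
    using H10_approx[OF v] by blast
  show "\<exists>\<phi>. (\<forall>k. \<phi> k \<in> test_functions \<Omega>) \<and>
       (\<lambda>k::nat. (\<integral>x. (\<phi> k x - (u x - v x))\<^sup>2 \<partial>lebesgue_on \<Omega>)
                 + (\<integral>x. (norm (gradient (\<phi> k) x - (g x - h x)))\<^sup>2 \<partial>lebesgue_on \<Omega>)) \<longlonglongrightarrow> 0"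
  proof (intro exI[of _ "\<lambda>k x. \<phi> k x - \<psi> k x"] conjI allI)
    show "(\<lambda>x. \<phi> k x - \<psi> k x) \<in> test_functions \<Omega>" for k by (rule test_functions_diff[OF \<phi>(1) \<psi>(1)])
    have 1: "(\<lambda>k. \<integral>x. (norm ((\<phi> k x - u x) - (\<psi> k x - v x)))\<^sup>2 \<partial>lebesgue_on \<Omega>) \<longlonglongrightarrow> 0"
      by (intro L2_diff_limit L2_on_diff \<phi> \<psi> test_function_L2 H10_L2(1)[OF u] H10_L2(1)[OF v])
    have 2: "(\<lambda>k. \<integral>x. (norm ((gradient (\<phi> k) x - g x) - (gradient (\<psi> k) x - h x)))\<^sup>2 \<partial>lebesgue_on \<Omega>) \<longlonglongrightarrow> 0"
      by (intro L2_diff_limit L2_on_diff \<phi> \<psi> test_function_L2 H10_L2(2)[OF u] H10_L2(2)[OF v])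
    have e: "(\<phi> k x - u x) - (\<psi> k x - v x) = (\<phi> k x - \<psi> k x) - (u x - v x)"
      "(gradient (\<phi> k) x - g x) - (gradient (\<psi> k) x - h x) = gradient (\<lambda>x. \<phi> k x - \<psi> k x) x - (g x - h x)" for k x
      using gradient_diff[OF test_functionD(2)[OF \<phi>(1)] test_functionD(2)[OF \<psi>(1)]] by auto
    show "(\<lambda>k::nat. (\<integral>x. ((\<phi> k x - \<psi> k x) - (u x - v x))\<^sup>2 \<partial>lebesgue_on \<Omega>)
                 + (\<integral>x. (norm (gradient (\<lambda>x. \<phi> k x - \<psi> k x) x - (g x - h x)))\<^sup>2 \<partial>lebesgue_on \<Omega>)) \<longlonglongrightarrow> 0"
      using tendsto_add[OF 1 2] unfolding e by simp
  qed
qed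

text \<open>Integrate the derivative of \<open>(x \<bullet> b) \<phi>\<^sup>2\<close> in one coordinate direction \<open>b\<close> and absorb half of
  \<open>\<phi>\<^sup>2\<close> by Young's inequality.\<close>
lemma Poincare:
  assumes \<phi>: "\<phi> \<in> test_functions \<Omega>"
  shows "(\<integral>x. (norm (\<phi> x))\<^sup>2 \<partial>lebesgue_on \<Omega>) \<le> 4 * R\<^sup>2 * (\<integral>x. (norm (gradient \<phi> x))\<^sup>2 \<partial>lebesgue_on \<Omega>)"
proof -
  obtain b :: 'a where b: "b \<in> Basis" using nonempty_Basis by blast
  note D = test_functionD[OF \<phi>]
  note V = test_function_vanishes[OF \<phi>]
  have [measurable]: "\<phi> \<in> borel_measurable borel" "gradient \<phi> \<in> borel_measurable borel"
    using D by (auto intro: borel_measurable_continuous_onI)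
  let ?\<psi>' = "\<lambda>x. (\<phi> x)\<^sup>2 + 2 * (x \<bullet> b) * \<phi> x * (gradient \<phi> x \<bullet> b)"
  have zero: "(\<integral>x. ?\<psi>' x \<partial>lborel) = 0"
  proof (rule integral_directional_derivative_zero[of "\<lambda>x. (x \<bullet> b) * (\<phi> x)\<^sup>2" b _ R])
    fix x
    have "((\<lambda>t. \<phi> (x + t *\<^sub>R b)) has_real_derivative (gradient \<phi> x \<bullet> b)) (at 0)"
      by (rule directional_derivative[OF has_derivative_gradient[OF D(2)]])
    then show "((\<lambda>t. ((x + t *\<^sub>R b) \<bullet> b) * (\<phi> (x + t *\<^sub>R b))\<^sup>2) has_real_derivative ?\<psi>' x) (at 0)"
      using b by (auto intro!: derivative_eq_intros simp: inner_add_left)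
  qed (use D V b in \<open>auto intro!: continuous_intros\<close>)
  have i1: "integrable lborel ?\<psi>'" "integrable lborel (\<lambda>x. (\<phi> x)\<^sup>2)" "integrable lborel (\<lambda>x. (norm (gradient \<phi> x))\<^sup>2)"
    by (rule integrable_compact_support[of _ R]; use D V in \<open>auto intro!: continuous_intros\<close>)+
  have pw: "(\<phi> x)\<^sup>2 \<le> ?\<psi>' x + (1/2 * (\<phi> x)\<^sup>2 + 2 * R\<^sup>2 * (norm (gradient \<phi> x))\<^sup>2)" for x
  proof (cases "norm x > R")
    case False
    let ?p = "gradient \<phi> x \<bullet> b"
    have "\<bar>x \<bullet> b\<bar> * \<bar>?p\<bar> \<le> R * norm (gradient \<phi> x)"
      using Basis_le_norm[OF b, of x] Basis_le_norm[OF b, of "gradient \<phi> x"] False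
      by (intro mult_mono) auto
    then have "\<bar>(x \<bullet> b) * ?p\<bar>\<^sup>2 \<le> (R * norm (gradient \<phi> x))\<^sup>2"
      by (intro power_mono) (auto simp: abs_mult)
    then have "((x \<bullet> b) * ?p)\<^sup>2 \<le> R\<^sup>2 * (norm (gradient \<phi> x))\<^sup>2" by (simp add: power_mult_distrib)
    moreover have "0 \<le> (\<phi> x + 2 * ((x \<bullet> b) * ?p))\<^sup>2" by simp
    ultimately show ?thesis by (simp add: power2_eq_square algebra_simps)
  qed (simp add: V)
  have "(\<integral>x. (\<phi> x)\<^sup>2 \<partial>lborel)
        \<le> (\<integral>x. ?\<psi>' x + (1/2 * (\<phi> x)\<^sup>2 + 2 * R\<^sup>2 * (norm (gradient \<phi> x))\<^sup>2) \<partial>lborel)"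
    by (intro integral_mono pw Bochner_Integration.integrable_add integrable_mult_right i1)
  also have "\<dots> = (\<integral>x. ?\<psi>' x \<partial>lborel) + (1/2 * (\<integral>x. (\<phi> x)\<^sup>2 \<partial>lborel) + 2 * R\<^sup>2 * (\<integral>x. (norm (gradient \<phi> x))\<^sup>2 \<partial>lborel))"
    using i1(2,3) by (subst Bochner_Integration.integral_add[OF i1(1)]) auto
  finally have "(\<integral>x. (\<phi> x)\<^sup>2 \<partial>lborel) \<le> 4 * R\<^sup>2 * (\<integral>x. (norm (gradient \<phi> x))\<^sup>2 \<partial>lborel)"
    using zero by simp
  then show ?thesis
    using D by (simp add: integral_lebesgue_on_vanishing[OF borel_dom])
qed

text \<open>The difference \<open>w\<close> of two solutions may be inserted into both weak equations, so its weak gradient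
  vanishes almost everywhere. Then \<open>w\<close> is a limit of test functions whose gradients tend to \<open>0\<close>,
  and these tend to \<open>0\<close> themselves by the Poincare inequality.\<close>
lemma weak_solution_unique:
  assumes "weak_Dirichlet_solution \<Omega> f u" "weak_Dirichlet_solution \<Omega> f v"
  shows "AE x in lebesgue_on \<Omega>. u x = v x"
proof -
  obtain g where u: "has_H10_gradient \<Omega> u g" and
    gu: "\<And>w h. has_H10_gradient \<Omega> w h \<Longrightarrow> (\<integral>x. g x \<bullet> h x \<partial>lebesgue_on \<Omega>) = (\<integral>x. f x * w x \<partial>lebesgue_on \<Omega>)"
    using assms(1) unfolding weak_Dirichlet_solution_def by blast
  obtain g' where v: "has_H10_gradient \<Omega> v g'" and
    gv: "\<And>w h. has_H10_gradient \<Omega> w h \<Longrightarrow> (\<integral>x. g' x \<bullet> h x \<partial>lebesgue_on \<Omega>) = (\<integral>x. f x * w x \<partial>lebesgue_on \<Omega>)"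
    using assms(2) unfolding weak_Dirichlet_solution_def by blast
  let ?M = "lebesgue_on \<Omega>"
  define w where "w x = u x - v x" for x
  define h where "h x = g x - g' x" for x
  have w: "has_H10_gradient \<Omega> w h" unfolding w_def h_def by (rule H10_diff[OF u v])
  note Lh = H10_L2(2)[OF w]
  have "(\<integral>x. (norm (h x))\<^sup>2 \<partial>?M) = (\<integral>x. g x \<bullet> h x - g' x \<bullet> h x \<partial>?M)"
    by (intro Bochner_Integration.integral_cong refl) (simp add: power2_norm_eq_inner h_def inner_diff_left)
  also have "\<dots> = 0"
    using L2_on_inner[OF H10_L2(2)[OF u] Lh] L2_on_inner[OF H10_L2(2)[OF v] Lh] gu[OF w] gv[OF w] by simp
  finally have h0: "AE x in ?M. h x = 0"
    using Lh by (subst (asm) integral_nonneg_eq_0_iff_AE) (auto simp: L2_on_def)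
  obtain \<phi> where \<phi>: "\<And>k::nat. \<phi> k \<in> test_functions \<Omega>"
    "(\<lambda>k. \<integral>x. (norm (\<phi> k x - w x))\<^sup>2 \<partial>?M) \<longlonglongrightarrow> 0"
    "(\<lambda>k. \<integral>x. (norm (gradient (\<phi> k) x - h x))\<^sup>2 \<partial>?M) \<longlonglongrightarrow> 0"
    using H10_approx[OF w] by blast
  have eq: "(\<integral>x. (norm (gradient (\<phi> k) x - h x))\<^sup>2 \<partial>?M) = (\<integral>x. (norm (gradient (\<phi> k) x))\<^sup>2 \<partial>?M)" for k
  proof (rule integral_cong_AE)
    have [measurable]: "h \<in> borel_measurable ?M" "gradient (\<phi> k) \<in> borel_measurable ?M"
      using Lh test_function_L2(2)[OF \<phi>(1)] by (auto simp: L2_on_def)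
    show "(\<lambda>x. (norm (gradient (\<phi> k) x - h x))\<^sup>2) \<in> borel_measurable ?M"
      "(\<lambda>x. (norm (gradient (\<phi> k) x))\<^sup>2) \<in> borel_measurable ?M" by measurable
    show "AE x in ?M. (norm (gradient (\<phi> k) x - h x))\<^sup>2 = (norm (gradient (\<phi> k) x))\<^sup>2"
      using h0 by eventually_elim simp
  qed
  have "(\<lambda>k. 4 * R\<^sup>2 * (\<integral>x. (norm (gradient (\<phi> k) x))\<^sup>2 \<partial>?M)) \<longlonglongrightarrow> 0"
    using tendsto_mult[OF tendsto_const \<phi>(3), of "4 * R\<^sup>2"] unfolding eq by simp
  note bound = this
  have p0: "(\<lambda>k. \<integral>x. (norm (\<phi> k x))\<^sup>2 \<partial>?M) \<longlonglongrightarrow> 0"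
  proof (rule tendsto_sandwich[OF _ _ tendsto_const bound])
    show "\<forall>\<^sub>F k in sequentially. (\<integral>x. (norm (\<phi> k x))\<^sup>2 \<partial>?M)
        \<le> 4 * R\<^sup>2 * (\<integral>x. (norm (gradient (\<phi> k) x))\<^sup>2 \<partial>?M)"
      using Poincare \<phi>(1) by (intro always_eventually) blast
  qed simp
  have "(\<lambda>k. \<integral>x. (norm (\<phi> k x - (\<phi> k x - w x)))\<^sup>2 \<partial>?M) \<longlonglongrightarrow> 0"
    by (intro L2_diff_limit p0 \<phi> L2_on_diff test_function_L2 H10_L2(1)[OF w])
  then have "(\<integral>x. (norm (w x))\<^sup>2 \<partial>?M) = 0" by (simp add: LIMSEQ_const_iff)
  then have "AE x in ?M. w x = 0"
    using H10_L2(1)[OF w] by (subst (asm) integral_nonneg_eq_0_iff_AE) (auto simp: L2_on_def)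
  then show ?thesis by (rule eventually_mono) (simp add: w_def)
qed

end

section \<open>Radial functions in \<open>H\<^sup>1\<^sub>0\<close> of the unit ball\<close>

lemma antiderivative_exists:
  fixes f :: "real \<Rightarrow> real"
  assumes "continuous_on UNIV f"
  obtains F where "\<And>t. (F has_real_derivative f t) (at t)" and "F 1 = 0"
proof
  let ?F = "\<lambda>u. LBINT y=1..ereal u. f y"
  show "(?F has_real_derivative f t) (at t)" for t
  proof -
    define a where "a = min t 1 - 1"
    define b where "b = max t 1 + 1"
    have ab: "a \<le> 1" "1 \<le> b" "a \<le> t" "t \<le> b" "t \<in> interior {a..b}"
      unfolding a_def b_def interior_atLeastAtMost_real by auto
    have "continuous_on {a..b} f" using assms continuous_on_subset by blast
    from interval_integral_FTC2[OF ab(1,2) this ab(3,4)]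
    have "(?F has_vector_derivative f t) (at t within {a..b})" by (simp add: one_ereal_def)
    then show ?thesis
      unfolding at_within_interior[OF ab(5)] has_real_derivative_iff_has_vector_derivative .
  qed
  show "?F 1 = 0" by (simp add: one_ereal_def)
qed

lemma polynomial_antiderivative:
  fixes p :: "real \<Rightarrow> real"
  assumes "real_polynomial_function p"
  obtains P where "\<And>t. (P has_real_derivative p t) (at t)" and "P 1 = 0" and "\<And>k. C_k k P"
proof -
  obtain a m where p: "p = (\<lambda>x. \<Sum>i\<le>m. a i * x ^ i)"
    using real_polynomial_function_imp_sum[OF assms] by blast
  let ?P = "\<lambda>t. \<Sum>i\<le>m. (a i / real (Suc i)) * (t ^ Suc i + (- 1))"
  show ?thesis
  proof
    show "(?P has_real_derivative p t) (at t)" for t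
    proof -
      have "(?P has_real_derivative (\<Sum>i\<le>m. (a i / real (Suc i)) * (real (Suc i) * t ^ i))) (at t)"
        by (intro DERIV_sum DERIV_cmult) (auto intro!: derivative_eq_intros simp del: power_Suc)
      then show ?thesis by (simp add: p)
    qed
    have id: "C_k k (\<lambda>t::real. t)" for k using C_k_inner[of k "1::real"] by simp
    show "C_k k ?P" for k
      by (intro C_k_sum C_k_mult C_k_add C_k_const C_k_power id) simp
  qed simp
qed

lemma C_k_inner_self: "C_k k (\<lambda>x::'a::euclidean_space. x \<bullet> x)"
proof -
  have "C_k k (\<lambda>x::'a. \<Sum>i\<in>Basis. (x \<bullet> i) * (x \<bullet> i))"
    by (intro C_k_sum C_k_mult C_k_inner) simp
  then show ?thesis by (simp add: euclidean_inner[symmetric])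
qed

text \<open>\<open>cutoff'\<close> is the derivative of \<open>cutoff\<close>, that is, \<open>s\<^sup>-\<^sup>2 e\<^sup>-\<^sup>1\<^sup>/\<^sup>s\<close> for \<open>s > 0\<close>. Composed with
  \<open>k (1 - t) - 1\<close> for growing \<open>k\<close>, \<open>cutoff\<close> switches off smoothly shortly before \<open>t = 1\<close> and tends
  to \<open>1\<close> for \<open>t < 1\<close>.\<close>
abbreviation cutoff :: "real \<Rightarrow> real" where "cutoff \<equiv> flat_exp 1"
abbreviation cutoff' :: "real \<Rightarrow> real" where "cutoff' \<equiv> flat_exp [:0,0,1:]"

lemma cutoff_deriv: "(cutoff has_real_derivative cutoff' s) (at s)"
  using flat_exp_deriv[of 1 s] by simp

lemma cutoff_bounds: "0 \<le> cutoff s" "cutoff s \<le> 1"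
  by (auto simp: flat_exp_def)

lemma cutoff_limit: "(cutoff \<longlongrightarrow> 1) at_top"
proof (rule Lim_transform_eventually)
  have "((\<lambda>s::real. exp (- inverse s)) \<longlongrightarrow> exp (- 0)) at_top"
    by (intro tendsto_intros tendsto_inverse_0_at_top filterlim_ident)
  then show "((\<lambda>s::real. exp (- inverse s)) \<longlongrightarrow> 1) at_top" by simp
  show "\<forall>\<^sub>F s in at_top. exp (- inverse s) = cutoff s"
    using eventually_gt_at_top[of 0] by eventually_elim (simp add: flat_exp_def inverse_eq_divide)
qed

lemma cutoff'_nonneg: "0 \<le> cutoff' s"
  by (simp add: flat_exp_def)

text \<open>The factor \<open>s + 1\<close> is \<open>k (1 - t)\<close> when \<open>s = k (1 - t) - 1\<close>. Functions that vanish at \<open>t = 1\<close>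
  are \<open>O(1 - t)\<close>, and this bound is what keeps the derivative of their truncations bounded.\<close>
lemma cutoff'_bound:
  assumes "s > 0" shows "(s + 1) * cutoff' s \<le> 2"
proof -
  define y where "y = 1 / s"
  have y: "y > 0" using assms by (simp add: y_def)
  have "1 + y + y\<^sup>2 / 2 \<le> exp y" by (rule exp_lower_Taylor_quadratic) (use y in simp)
  then have "y + y\<^sup>2 \<le> 2 * exp y" using y by (simp add: power2_eq_square)
  then have "(y + y\<^sup>2) * exp (- y) \<le> 2" by (simp add: exp_minus field_simps)
  moreover have "(s + 1) * cutoff' s = (y + y\<^sup>2) * exp (- y)"
    using assms by (simp add: flat_exp_def y_def field_simps power2_eq_square)
  ultimately show ?thesis by simp
qed

lemma cutoff'_limit: "((\<lambda>s. (s + 1) * cutoff' s) \<longlongrightarrow> 0) at_top"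
proof (rule tendsto_sandwich[OF _ _ tendsto_const])
  have "((\<lambda>s::real. inverse s + (inverse s)\<^sup>2) \<longlongrightarrow> 0 + 0\<^sup>2) at_top"
    by (intro tendsto_intros tendsto_inverse_0_at_top filterlim_ident)
  then show "((\<lambda>s::real. inverse s + (inverse s)\<^sup>2) \<longlongrightarrow> 0) at_top" by simp
  show "\<forall>\<^sub>F s in at_top. (s + 1) * cutoff' s \<le> inverse s + (inverse s)\<^sup>2"
    using eventually_gt_at_top[of 0]
  proof eventually_elim
    fix s :: real assume s: "0 < s"
    have "(s + 1) * cutoff' s = (inverse s + (inverse s)\<^sup>2) * exp (- (1 / s))"
      using s by (simp add: flat_exp_def field_simps power2_eq_square)
    also have "\<dots> \<le> (inverse s + (inverse s)\<^sup>2) * 1"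
      using s by (intro mult_left_mono) auto
    finally show "(s + 1) * cutoff' s \<le> inverse s + (inverse s)\<^sup>2" by simp
  qed
  show "\<forall>\<^sub>F s in at_top. 0 \<le> (s + 1) * cutoff' s"
    using eventually_gt_at_top[of 0] by eventually_elim (simp add: cutoff'_nonneg)
qed

text \<open>Approximate \<open>V'\<close> uniformly on \<open>[0,1]\<close> by polynomials, integrate these to polynomials \<open>P\<^sub>k\<close>
  that vanish at \<open>1\<close>, and multiply by the cutoff. The term in which the cutoff is differentiated
  has size \<open>O(1 - t) k cutoff'\<close>; by the two lemmas above it stays bounded and tends to \<open>0\<close>
  pointwise. Bounded pointwise convergence is all that dominated convergence needs.\<close>
lemma C1_approx_vanishing_near_1:
  fixes V V' :: "real \<Rightarrow> real"
  assumes V: "\<And>t. (V has_real_derivative V' t) (at t)" and V': "continuous_on UNIV V'" and V1: "V 1 = 0"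
  shows "\<exists>(F :: nat \<Rightarrow> real \<Rightarrow> real) F' B.
    (\<forall>k j. C_k j (F k)) \<and> (\<forall>k t. (F k has_real_derivative F' k t) (at t)) \<and>
    (\<forall>k t. 1 - 1 / real (Suc k) \<le> t \<longrightarrow> F k t = 0) \<and>
    (\<forall>k. \<forall>t\<in>{0..1}. \<bar>F k t - V t\<bar> \<le> B \<and> \<bar>F' k t - V' t\<bar> \<le> B) \<and>
    (\<forall>t\<in>{0..<1}. (\<lambda>k. F k t) \<longlonglongrightarrow> V t \<and> (\<lambda>k. F' k t) \<longlonglongrightarrow> V' t)"
proof -
  have cV': "continuous_on {0..1} V'" using V' continuous_on_subset by blast
  have "\<exists>p P. (\<forall>t\<in>{0..1}. \<bar>V' t - p t\<bar> < 1 / real (Suc k)) \<and>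
      (\<forall>t. (P has_real_derivative p t) (at t)) \<and> P 1 = 0 \<and> (\<forall>j. C_k j P)" for k
  proof -
    obtain p where p: "real_polynomial_function p" "\<And>t. t \<in> {0..1} \<Longrightarrow> \<bar>V' t - p t\<bar> < 1 / real (Suc k)"
      using Stone_Weierstrass_real_polynomial_function[OF _ cV', of "1 / real (Suc k)"] by auto
    obtain P where "\<And>t. (P has_real_derivative p t) (at t)" "P 1 = 0" "\<And>j. C_k j P"
      using polynomial_antiderivative[OF p(1)] by metis
    then show ?thesis using p(2) by blast
  qed
  then obtain p P where p: "\<And>k t. t \<in> {0..1} \<Longrightarrow> \<bar>V' t - p k t\<bar> < 1 / real (Suc k)"
    and P: "\<And>k t. (P k has_real_derivative p k t) (at t)" and P1: "\<And>k. P k 1 = 0" and CP: "\<And>k j. C_k j (P k)"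
    by metis
  have "bounded (V' ` {0..1})"
    using compact_continuous_image[OF cV'] compact_imp_bounded by blast
  then obtain L0 where L0: "\<And>t. t \<in> {0..1} \<Longrightarrow> \<bar>V' t\<bar> \<le> L0"
    unfolding bounded_iff by (metis imageI real_norm_def)
  define L where "L = L0 + 1"
  have L: "L \<ge> 1" using L0[of 0] by (simp add: L_def)
  have V'L: "\<bar>V' t\<bar> \<le> L" if "t \<in> {0..1}" for t using L0[OF that] by (simp add: L_def)
  have pL: "\<bar>p k t\<bar> \<le> L" if "t \<in> {0..1}" for k t
  proof -
    have "1 / real (Suc k) \<le> 1" by simp
    then show ?thesis using p[OF that, of k] L0[OF that] unfolding L_def by linarith
  qed
  have growth: "\<bar>f t\<bar> \<le> c * (1 - t)"
    if "\<And>t. (f has_real_derivative f' t) (at t)" "f 1 = 0" "\<And>t. t \<in> {0..1} \<Longrightarrow> \<bar>f' t\<bar> \<le> c" "0 \<le> t" "t \<le> 1"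
    for f f' :: "real \<Rightarrow> real" and c t
  proof (cases "t = 1")
    case False
    then have "t < 1" using that(5) by simp
    from MVT2[OF this, of f f'] that(1)
    obtain z where z: "t < z" "z < 1" "f 1 - f t = (1 - t) * f' z" by blast
    have "\<bar>f t\<bar> = \<bar>f 1 - f t\<bar>" using that(2) by simp
    also have "\<dots> = (1 - t) * \<bar>f' z\<bar>" unfolding z(3) using z(1,2) by (simp add: abs_mult)
    also have "\<dots> \<le> (1 - t) * c" using z that by (intro mult_left_mono) auto
    finally show ?thesis by (simp add: mult.commute)
  qed (use that in simp)
  define \<sigma> where "\<sigma> k t = real (Suc k) * (1 - t) - 1" for k t
  define F where "F k t = P k t * cutoff (\<sigma> k t)" for k t
  define F' where "F' k t = p k t * cutoff (\<sigma> k t) - P k t * (real (Suc k) * cutoff' (\<sigma> k t))" for k t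
  have PL: "\<bar>P k t\<bar> \<le> L * (1 - t)" if "0 \<le> t" "t \<le> 1" for k t
    by (rule growth[OF P P1 pL that])
  have VL: "\<bar>V t\<bar> \<le> L * (1 - t)" if "0 \<le> t" "t \<le> 1" for t
    by (rule growth[OF V V1 V'L that])
  have PV: "\<bar>P k t - V t\<bar> \<le> 1 / real (Suc k) * (1 - t)" if "0 \<le> t" "t \<le> 1" for k t
    by (rule growth[OF DERIV_diff[OF P V] _ _ that])
      (use P1 V1 p in \<open>auto simp: abs_minus_commute intro: less_imp_le\<close>)
  have L1: "L * (1 - t) \<le> L" if "0 \<le> t" for t
    using L that by (simp add: mult_le_cancel_left1)
  have small: "\<bar>P k t * (real (Suc k) * cutoff' (\<sigma> k t))\<bar> \<le> L * ((\<sigma> k t + 1) * cutoff' (\<sigma> k t))"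
    if "0 \<le> t" "t \<le> 1" for k t
  proof -
    have "\<bar>P k t * (real (Suc k) * cutoff' (\<sigma> k t))\<bar> = \<bar>P k t\<bar> * (real (Suc k) * cutoff' (\<sigma> k t))"
      using cutoff'_nonneg by (simp add: abs_mult)
    also have "\<dots> \<le> L * (1 - t) * (real (Suc k) * cutoff' (\<sigma> k t))"
      using PL[OF that] cutoff'_nonneg by (intro mult_right_mono) auto
    finally show ?thesis by (simp add: \<sigma>_def algebra_simps)
  qed
  have small2: "L * ((\<sigma> k t + 1) * cutoff' (\<sigma> k t)) \<le> 2 * L" for k t
  proof (cases "\<sigma> k t > 0")
    case True
    then show ?thesis using mult_left_mono[OF cutoff'_bound[OF True], of L] L by simp
  next
    case False
    then show ?thesis using L by (simp add: flat_exp_def)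
  qed
  have \<sigma>_lim: "filterlim (\<lambda>k. \<sigma> k t) at_top sequentially" if "t < 1" for t
  proof -
    have "filterlim (\<lambda>k. (1 - t) * real (Suc k)) at_top sequentially"
      using that by (intro filterlim_tendsto_pos_mult_at_top[OF tendsto_const]
          filterlim_compose[OF filterlim_real_sequentially filterlim_Suc]) auto
    from filterlim_tendsto_add_at_top[OF tendsto_const this, of "-1"]
    show ?thesis by (simp add: \<sigma>_def mult.commute)
  qed
  show ?thesis
  proof (rule exI[of _ F], rule exI[of _ F'], rule exI[of _ "4 * L"], intro conjI allI impI ballI)
    show "C_k j (F k)" for j k
    proof -
      have "C_k j (\<lambda>t::real. (- real (Suc k)) * (t \<bullet> 1) + real k)"
        by (intro C_k_add C_k_mult C_k_const C_k_inner)
      moreover have "(\<lambda>t. (- real (Suc k)) * (t \<bullet> 1) + real k) = \<sigma> k"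
        by (auto simp: \<sigma>_def algebra_simps)
      ultimately have "C_k j (\<sigma> k)" by (simp only:)
      then have "C_k j (\<lambda>t. P k t * cutoff (\<sigma> k t))"
        by (intro C_k_mult CP C_k_compose[OF C_k_flat_exp])
      then show ?thesis by (simp add: F_def[abs_def])
    qed
    show "(F k has_real_derivative F' k t) (at t)" for k t
    proof -
      have "(\<sigma> k has_real_derivative - real (Suc k)) (at t)"
        unfolding \<sigma>_def[abs_def] by (auto intro!: derivative_eq_intros)
      from DERIV_mult[OF P DERIV_chain2[OF cutoff_deriv this], of k]
      show ?thesis unfolding F_def[abs_def] F'_def by (rule DERIV_cong) (simp add: algebra_simps)
    qed
    show "F k t = 0" if "1 - 1 / real (Suc k) \<le> t" for k t
    proof -
      have "\<sigma> k t \<le> 0" using that by (simp add: \<sigma>_def field_simps)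
      then show ?thesis by (simp add: F_def flat_exp_def)
    qed
    show "\<bar>F k t - V t\<bar> \<le> 4 * L" if "t \<in> {0..1}" for k t
    proof -
      have t: "0 \<le> t" "t \<le> 1" using that by auto
      have "\<bar>F k t\<bar> \<le> \<bar>P k t\<bar>"
        using cutoff_bounds[of "\<sigma> k t"] by (simp add: F_def abs_mult mult_left_le)
      then show ?thesis using PL[OF t, of k] VL[OF t] L1[OF t(1)] L by linarith
    qed
    show "\<bar>F' k t - V' t\<bar> \<le> 4 * L" if "t \<in> {0..1}" for k t
    proof -
      have t: "0 \<le> t" "t \<le> 1" using that by auto
      have "\<bar>p k t * cutoff (\<sigma> k t)\<bar> \<le> \<bar>p k t\<bar>"
        using cutoff_bounds[of "\<sigma> k t"] by (simp add: abs_mult mult_left_le)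
      then show ?thesis
        using pL[OF that, of k] V'L[OF that] small[OF t, of k] small2[of k t] unfolding F'_def
        by linarith
    qed
    fix t :: real assume "t \<in> {0..<1}"
    then have t: "0 \<le> t" "t < 1" by auto
    have inv: "(\<lambda>k. 1 / real (Suc k)) \<longlonglongrightarrow> 0"
      using LIMSEQ_inverse_real_of_nat by (simp add: inverse_eq_divide)
    have "(\<lambda>k. P k t - V t) \<longlonglongrightarrow> 0"
    proof (rule Lim_null_comparison)
      show "\<forall>\<^sub>F k in sequentially. norm (P k t - V t) \<le> 1 / real (Suc k) * (1 - t)"
        using PV t by (intro always_eventually) auto
      show "(\<lambda>k. 1 / real (Suc k) * (1 - t)) \<longlonglongrightarrow> 0"
        using tendsto_mult[OF inv tendsto_const, of "1 - t"] by simp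
    qed
    then have PV_lim: "(\<lambda>k. P k t) \<longlonglongrightarrow> V t" by (simp add: LIM_zero_iff)
    have "(\<lambda>k. p k t - V' t) \<longlonglongrightarrow> 0"
    proof (rule Lim_null_comparison[OF _ inv])
      show "\<forall>\<^sub>F k in sequentially. norm (p k t - V' t) \<le> 1 / real (Suc k)"
        using p[of t] t by (intro always_eventually) (auto simp: abs_minus_commute intro: less_imp_le)
    qed
    then have pV_lim: "(\<lambda>k. p k t) \<longlonglongrightarrow> V' t" by (simp add: LIM_zero_iff)
    have c1: "(\<lambda>k. cutoff (\<sigma> k t)) \<longlonglongrightarrow> 1"
      by (rule filterlim_compose[OF cutoff_limit \<sigma>_lim[OF t(2)]])
    show "(\<lambda>k. F k t) \<longlonglongrightarrow> V t"
      using tendsto_mult[OF PV_lim c1] by (simp add: F_def)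
    have "(\<lambda>k. L * ((\<sigma> k t + 1) * cutoff' (\<sigma> k t))) \<longlonglongrightarrow> 0"
      using tendsto_mult[OF tendsto_const filterlim_compose[OF cutoff'_limit \<sigma>_lim[OF t(2)]], of L] by simp
    then have "(\<lambda>k. P k t * (real (Suc k) * cutoff' (\<sigma> k t))) \<longlonglongrightarrow> 0"
      by (rule Lim_null_comparison[rotated]) (use small t in \<open>auto intro!: always_eventually\<close>)
    from tendsto_diff[OF tendsto_mult[OF pV_lim c1] this]
    show "(\<lambda>k. F' k t) \<longlonglongrightarrow> V' t" by (simp add: F'_def)
  qed
qed

context bounded_domain
begin

lemma L2_dominated_to_0:
  fixes a :: "nat \<Rightarrow> 'a \<Rightarrow> 'b::euclidean_space"
  assumes "\<And>k. a k \<in> borel_measurable (lebesgue_on \<Omega>)"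
    and "\<And>k x. x \<in> \<Omega> \<Longrightarrow> norm (a k x) \<le> B"
    and "\<And>x. x \<in> \<Omega> \<Longrightarrow> (\<lambda>k. a k x) \<longlonglongrightarrow> 0"
  shows "(\<lambda>k. \<integral>x. (norm (a k x))\<^sup>2 \<partial>lebesgue_on \<Omega>) \<longlonglongrightarrow> 0"
proof -
  have [measurable]: "a k \<in> borel_measurable (lebesgue_on \<Omega>)" for k by fact
  have "(\<lambda>k. \<integral>x. (norm (a k x))\<^sup>2 \<partial>lebesgue_on \<Omega>) \<longlonglongrightarrow> (\<integral>x. 0 \<partial>lebesgue_on \<Omega>)"
  proof (rule integral_dominated_convergence)
    show "integrable (lebesgue_on \<Omega>) (\<lambda>x. B\<^sup>2)"
      by (rule finite_measure.integrable_const[OF finite_measureI])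
        (use emeasure_lebesgue_on_finite[OF borel_dom bounded_dom] in auto)
    show "AE x in lebesgue_on \<Omega>. (\<lambda>k. (norm (a k x))\<^sup>2) \<longlonglongrightarrow> 0"
    proof (intro AE_I2)
      fix x assume "x \<in> space (lebesgue_on \<Omega>)"
      then have "(\<lambda>k. (norm (a k x))\<^sup>2) \<longlonglongrightarrow> (norm (0::'b))\<^sup>2"
        by (intro tendsto_intros assms(3)) simp
      then show "(\<lambda>k. (norm (a k x))\<^sup>2) \<longlonglongrightarrow> 0" by simp
    qed
    show "AE x in lebesgue_on \<Omega>. norm ((norm (a k x))\<^sup>2) \<le> B\<^sup>2" for k
      by (intro AE_I2) (use assms(2) in \<open>auto intro!: power_mono\<close>)
  qed auto
  then show ?thesis by simp
qed

end

text \<open>Radial functions are written as functions of \<open>x \<bullet> x\<close> rather than of the norm, so that they are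
  smooth at the origin as soon as the profile is.\<close>
lemma has_derivative_radial:
  fixes x :: "'a::euclidean_space"
  assumes "(F has_real_derivative F' (x \<bullet> x)) (at (x \<bullet> x))"
  shows "((\<lambda>x. F (x \<bullet> x)) has_derivative (\<lambda>v. ((2 * F' (x \<bullet> x)) *\<^sub>R x) \<bullet> v)) (at x)"
proof -
  have 1: "((\<lambda>x. x \<bullet> x) has_derivative (\<lambda>v. 2 * (x \<bullet> v))) (at x)"
    by (auto intro!: derivative_eq_intros simp: inner_commute)
  have 2: "(F has_derivative (\<lambda>h. F' (x \<bullet> x) * h)) (at (x \<bullet> x))"
    using assms by (simp add: has_field_derivative_def)
  show ?thesis
    by (rule has_derivative_eq_rhs[OF has_derivative_compose[OF 1 2]]) (auto simp: mult_ac)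
qed

interpretation unit_ball: bounded_domain "ball (0::'a::euclidean_space) 1" 1
  by unfold_locales auto

text \<open>Membership in \<open>H\<^sup>1\<^sub>0\<close> comes from the one-dimensional approximation of the profile; the weak
  gradient is the classical one because \<open>V (x \<bullet> x)\<close> times a test function is \<open>C\<^sup>1\<close> with compact
  support.\<close>
lemma radial_has_H10_gradient:
  fixes V V' :: "real \<Rightarrow> real"
  assumes V: "\<And>t. (V has_real_derivative V' t) (at t)" and V': "continuous_on UNIV V'" and V1: "V 1 = 0"
  shows "has_H10_gradient (ball 0 1) (\<lambda>x::'a::euclidean_space. V (x \<bullet> x)) (\<lambda>x. (2 * V' (x \<bullet> x)) *\<^sub>R x)"
    (is "has_H10_gradient ?B ?u ?g")
proof -
  have cV: "continuous_on UNIV V"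
    using V by (auto intro!: continuous_at_imp_continuous_on DERIV_isCont)
  have cu: "continuous_on UNIV ?u" and cg: "continuous_on UNIV ?g"
    by (auto intro!: continuous_intros continuous_on_compose2[OF cV] continuous_on_compose2[OF V'])
  have L2_cont: "L2_on ?B f" if c: "continuous_on UNIV f" for f :: "'a \<Rightarrow> 'b::euclidean_space"
  proof -
    have "compact (f ` cball 0 1)"
      by (intro compact_continuous_image continuous_on_subset[OF c]) auto
    then obtain M where "\<And>x. x \<in> cball 0 1 \<Longrightarrow> norm (f x) \<le> M"
      using compact_imp_bounded bounded_iff by (metis imageI)
    then show ?thesis
      using c by (intro L2_on_bounded[of _ _ M] borel_measurable_lebesgue_on borel_measurable_continuous_onI) auto
  qed
  note Lu = L2_cont[OF cu] and Lg = L2_cont[OF cg]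
  obtain F :: "nat \<Rightarrow> real \<Rightarrow> real" and F' B where F: "\<forall>k j. C_k j (F k)" "\<forall>k t. (F k has_real_derivative F' k t) (at t)"
    "\<forall>k t. 1 - 1 / real (Suc k) \<le> t \<longrightarrow> F k t = 0"
    "\<forall>k. \<forall>t\<in>{0..1}. \<bar>F k t - V t\<bar> \<le> B \<and> \<bar>F' k t - V' t\<bar> \<le> B"
    "\<forall>t\<in>{0..<1}. (\<lambda>k. F k t) \<longlonglongrightarrow> V t \<and> (\<lambda>k. F' k t) \<longlonglongrightarrow> V' t"
    using C1_approx_vanishing_near_1[OF V V' V1] by blast
  define \<phi> where "\<phi> k x = F k (x \<bullet> x)" for k and x :: 'a
  have in_ball: "0 \<le> x \<bullet> x" "x \<bullet> x < 1" if "x \<in> ?B" for x :: 'a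
    using that by (auto simp: dot_square_norm abs_square_less_1)
  have \<phi>: "\<phi> k \<in> test_functions ?B" for k
  proof -
    have "C_k j (\<phi> k)" for j
      unfolding \<phi>_def[abs_def] by (rule C_k_compose[OF F(1)[rule_format] C_k_inner_self])
    moreover have "closure {x. \<phi> k x \<noteq> 0} \<subseteq> {x. x \<bullet> x \<le> 1 - 1 / real (Suc k)}"
    proof (rule closure_minimal)
      show "{x. \<phi> k x \<noteq> 0} \<subseteq> {x. x \<bullet> x \<le> 1 - 1 / real (Suc k)}"
      proof (clarify, rule ccontr)
        fix x assume "\<phi> k x \<noteq> 0" "\<not> x \<bullet> x \<le> 1 - 1 / real (Suc k)"
        then show False using F(3)[rule_format, of k "x \<bullet> x"] by (simp add: \<phi>_def)
      qed
      show "closed {x::'a. x \<bullet> x \<le> 1 - 1 / real (Suc k)}"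
        by (intro closed_Collect_le continuous_intros)
    qed
    moreover have "{x::'a. x \<bullet> x \<le> 1 - 1 / real (Suc k)} \<subseteq> ?B"
    proof
      fix x :: 'a assume "x \<in> {x. x \<bullet> x \<le> 1 - 1 / real (Suc k)}"
      moreover have "1 - 1 / real (Suc k) < 1" by simp
      ultimately have "(norm x)\<^sup>2 < 1" by (simp only: mem_Collect_eq dot_square_norm)
      then show "x \<in> ?B" by (simp add: abs_square_less_1)
    qed
    ultimately have C: "\<And>j. C_k j (\<phi> k)" and S: "closure {x. \<phi> k x \<noteq> 0} \<subseteq> ?B" by blast+
    have "bounded (closure {x. \<phi> k x \<noteq> 0})" using bounded_ball bounded_subset S by blast
    then have "compact (closure {x. \<phi> k x \<noteq> 0})" by (simp add: compact_eq_bounded_closed)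
    then show ?thesis using C S unfolding test_functions_def by blast
  qed
  have grad: "gradient (\<phi> k) x = (2 * F' k (x \<bullet> x)) *\<^sub>R x" for k x
    unfolding \<phi>_def[abs_def] by (rule gradient_eqI, rule has_derivative_radial) (use F(2) in blast)
  have lim: "(\<lambda>k. \<integral>x. (norm (\<phi> k x - ?u x))\<^sup>2 \<partial>lebesgue_on ?B) \<longlonglongrightarrow> 0"
  proof (rule unit_ball.L2_dominated_to_0)
    show "(\<lambda>x. \<phi> k x - ?u x) \<in> borel_measurable (lebesgue_on ?B)" for k
      using L2_on_diff[OF unit_ball.test_function_L2(1)[OF \<phi>] Lu] by (simp add: L2_on_def)
    show "norm (\<phi> k x - ?u x) \<le> B" if "x \<in> ?B" for k x
      using F(4) in_ball[OF that] by (simp add: \<phi>_def)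
    show "(\<lambda>k. \<phi> k x - ?u x) \<longlonglongrightarrow> 0" if "x \<in> ?B" for x
      using F(5) in_ball[OF that] by (simp add: \<phi>_def LIM_zero)
  qed
  have lim': "(\<lambda>k. \<integral>x. (norm (gradient (\<phi> k) x - ?g x))\<^sup>2 \<partial>lebesgue_on ?B) \<longlonglongrightarrow> 0"
  proof (rule unit_ball.L2_dominated_to_0)
    show "(\<lambda>x. gradient (\<phi> k) x - ?g x) \<in> borel_measurable (lebesgue_on ?B)" for k
      using L2_on_diff[OF unit_ball.test_function_L2(2)[OF \<phi>] Lg] by (simp add: L2_on_def)
    have e: "gradient (\<phi> k) x - ?g x = (2 * (F' k (x \<bullet> x) - V' (x \<bullet> x))) *\<^sub>R x" for k x
      by (simp add: grad algebra_simps)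
    show "norm (gradient (\<phi> k) x - ?g x) \<le> 2 * B" if "x \<in> ?B" for k x
    proof -
      have "norm (gradient (\<phi> k) x - ?g x) = 2 * \<bar>F' k (x \<bullet> x) - V' (x \<bullet> x)\<bar> * norm x"
        by (simp only: e norm_scaleR abs_mult)
      also have "\<dots> \<le> 2 * \<bar>F' k (x \<bullet> x) - V' (x \<bullet> x)\<bar> * 1"
        using that by (intro mult_left_mono) auto
      also have "\<dots> \<le> 2 * B" using F(4) in_ball[OF that] by simp
      finally show ?thesis .
    qed
    show "(\<lambda>k. gradient (\<phi> k) x - ?g x) \<longlonglongrightarrow> 0" if "x \<in> ?B" for x
    proof -
      have "(\<lambda>k. F' k (x \<bullet> x) - V' (x \<bullet> x)) \<longlonglongrightarrow> 0"
        using F(5) in_ball[OF that] by (intro LIM_zero) simp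
      then have "(\<lambda>k. (2 * (F' k (x \<bullet> x) - V' (x \<bullet> x))) *\<^sub>R x) \<longlonglongrightarrow> (2 * 0) *\<^sub>R x"
        by (intro tendsto_intros)
      then show ?thesis by (simp add: e)
    qed
  qed
  have parts: "(\<integral>x. ?u x * partial_deriv \<psi> i x \<partial>lebesgue_on ?B) = - (\<integral>x. (?g x \<bullet> i) * \<psi> x \<partial>lebesgue_on ?B)"
    if \<psi>: "\<psi> \<in> test_functions ?B" and i: "i \<in> Basis" for \<psi> i
  proof -
    note D = test_functionD[OF \<psi>]
    note Z = unit_ball.test_function_vanishes[OF \<psi>]
    let ?d = "\<lambda>x. ?u x * (gradient \<psi> x \<bullet> i) + (?g x \<bullet> i) * \<psi> x"
    have zero: "(\<integral>x. ?d x \<partial>lborel) = 0"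
    proof (rule integral_directional_derivative_zero[of "\<lambda>x. ?u x * \<psi> x" i _ 1])
      fix x
      have 1: "((\<lambda>t. \<psi> (x + t *\<^sub>R i)) has_real_derivative (gradient \<psi> x \<bullet> i)) (at 0)"
        by (rule directional_derivative[OF has_derivative_gradient[OF D(2)]])
      have 2: "((\<lambda>t. ?u (x + t *\<^sub>R i)) has_real_derivative (?g x \<bullet> i)) (at 0)"
        by (rule directional_derivative, rule has_derivative_radial) (rule V)
      show "((\<lambda>t. ?u (x + t *\<^sub>R i) * \<psi> (x + t *\<^sub>R i)) has_real_derivative ?d x) (at 0)"
        using DERIV_mult[OF 2 1] by (simp add: algebra_simps)
    qed (use D Z i cu cg in \<open>auto intro!: continuous_intros simp del: inner_scaleR_left\<close>)
    have i1: "integrable lborel (\<lambda>x. ?u x * (gradient \<psi> x \<bullet> i))"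
      by (rule integrable_compact_support[of _ 1]) (use D Z cu in \<open>auto intro!: continuous_intros\<close>)
    have i2: "integrable lborel (\<lambda>x. (?g x \<bullet> i) * \<psi> x)"
      by (rule integrable_compact_support[of _ 1]) (use D Z cg in \<open>auto intro!: continuous_intros simp del: inner_scaleR_left\<close>)
    have "(\<integral>x. ?u x * (gradient \<psi> x \<bullet> i) \<partial>lborel) = - (\<integral>x. (?g x \<bullet> i) * \<psi> x \<partial>lborel)"
      using zero Bochner_Integration.integral_add[OF i1 i2] by linarith
    moreover have "(\<integral>x. ?u x * (gradient \<psi> x \<bullet> i) \<partial>lebesgue_on ?B) = (\<integral>x. ?u x * (gradient \<psi> x \<bullet> i) \<partial>lborel)"
      using i1 D by (intro integral_lebesgue_on_vanishing) auto
    moreover have "(\<integral>x. (?g x \<bullet> i) * \<psi> x \<partial>lebesgue_on ?B) = (\<integral>x. (?g x \<bullet> i) * \<psi> x \<partial>lborel)"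
      using i2 D by (intro integral_lebesgue_on_vanishing) auto
    ultimately show ?thesis using i by (simp add: gradient_inner_Basis)
  qed
  have "(\<lambda>k::nat. (\<integral>x. (\<phi> k x - ?u x)\<^sup>2 \<partial>lebesgue_on ?B)
                 + (\<integral>x. (norm (gradient (\<phi> k) x - ?g x))\<^sup>2 \<partial>lebesgue_on ?B)) \<longlonglongrightarrow> 0"
    using tendsto_add[OF lim lim'] by simp
  then show ?thesis
    unfolding has_H10_gradient_def has_H1_gradient_def using Lu Lg parts \<phi> by blast
qed

section \<open>Explicit solutions for radial sets\<close>

text \<open>At \<open>t = |x|\<^sup>2\<close> this is \<open>min(1, s/|x|\<^sup>n)\<close>, the kernel of the flux identity in the variable of the
  radial profiles. The maximum in the denominator keeps it continuous at \<open>t = 0\<close>, and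
  the absolute value makes it continuous for all real \<open>t\<close>.\<close>
definition kern :: "nat \<Rightarrow> real \<Rightarrow> real \<Rightarrow> real" where
  "kern n s t = s / max s (sqrt \<bar>t\<bar> ^ n)"

lemma continuous_kern: "0 < s \<Longrightarrow> continuous_on UNIV (kern n s)"
proof -
  assume s: "0 < s"
  then have "max s (sqrt \<bar>t\<bar> ^ n) \<noteq> 0" for t by (metis max.cobounded1 not_le)
  then show ?thesis unfolding kern_def[abs_def] by (intro continuous_intros) auto
qed

lemma kern_inner_self: "kern n s (x \<bullet> x) = s / max s (norm x ^ n)"
  by (simp add: kern_def norm_eq_sqrt_inner)

text \<open>Superposition: a set whose indicator is almost everywhere a linear combination of indicators of
  centred balls \<open>|x|\<^sup>n < s\<^sub>i\<close> has a solution whose gradient is the same combination of the fields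
  \<open>- min(1, s\<^sub>i/|x|\<^sup>n) x / n\<close> of these balls.\<close>
lemma weak_solution_radial:
  fixes V :: "real \<Rightarrow> real" and E :: "'a::euclidean_space set"
  assumes s: "\<And>i. i \<in> I \<Longrightarrow> 0 < s i"
    and E: "E \<in> sets borel"
    and ind: "AE x in lborel. indicator E x = (\<Sum>i\<in>I. c i * indicator {x. norm x ^ DIM('a) < s i} x)"
    and V: "\<And>t. (V has_real_derivative - (\<Sum>i\<in>I. c i * kern DIM('a) (s i) t) / (2 * real DIM('a))) (at t)"
    and V1: "V 1 = 0"
  shows "weak_Dirichlet_solution (ball 0 1) (indicator E) (\<lambda>x::'a. V (x \<bullet> x))"
proof -
  let ?n = "DIM('a)"
  let ?B = "ball (0::'a) 1"
  let ?K = "\<lambda>i x::'a. s i / max (s i) (norm x ^ ?n)"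
  let ?S = "\<lambda>i. {x::'a. norm x ^ ?n < s i}"
  let ?V' = "\<lambda>t. - (\<Sum>i\<in>I. c i * kern ?n (s i) t) / (2 * real ?n)"
  have V': "continuous_on UNIV ?V'"
    by (intro continuous_intros continuous_kern s) auto
  show ?thesis
  proof (rule unit_ball.weak_solution_from_test_functions[OF radial_has_H10_gradient[OF V V' V1]])
    show "L2_on ?B (indicat_real E)"
      by (rule L2_on_bounded[OF _ _ borel_measurable_lebesgue_on[OF borel_measurable_indicator[OF E]], of _ 1])
        (auto simp: indicator_def)
    fix \<phi> assume \<phi>: "\<phi> \<in> test_functions ?B"
    note D = test_functionD[OF \<phi>]
    note Z = unit_ball.test_function_vanishes[OF \<phi>]
    have [measurable]: "\<phi> \<in> borel_measurable borel" "gradient \<phi> \<in> borel_measurable borel"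
      using D by (auto intro: borel_measurable_continuous_onI)
    have [measurable]: "E \<in> sets borel" by fact
    have cV'x: "continuous_on UNIV (\<lambda>x::'a. ?V' (x \<bullet> x))"
      by (rule continuous_on_compose2[OF V']) (auto intro!: continuous_intros)
    have iK: "integrable lborel (\<lambda>x. ?K i x * (gradient \<phi> x \<bullet> x))" if "i \<in> I" for i
    proof (rule integrable_compact_support[of _ 1])
      have "max (s i) (norm x ^ ?n) \<noteq> 0" for x :: 'a
        using s[OF that] by (metis max.cobounded1 not_le)
      then show "continuous_on UNIV (\<lambda>x. ?K i x * (gradient \<phi> x \<bullet> x))"
        using D by (intro continuous_intros) auto
    qed (simp add: Z)
    have i\<phi>: "integrable lborel (\<lambda>x. indicat_real (?S i) x * \<phi> x)" for i
    proof -
      have [measurable]: "?S i \<in> sets borel" by measurable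
      have "integrable lborel \<phi>" by (rule integrable_compact_support[OF D(3) Z(1)])
      then show ?thesis
        by (rule Bochner_Integration.integrable_bound) (auto simp: indicator_def)
    qed
    have "(\<integral>x. ((2 * ?V' (x \<bullet> x)) *\<^sub>R x) \<bullet> gradient \<phi> x \<partial>lebesgue_on ?B)
        = (\<integral>x. ((2 * ?V' (x \<bullet> x)) *\<^sub>R x) \<bullet> gradient \<phi> x \<partial>lborel)"
    proof (rule integral_lebesgue_on_vanishing)
      have "continuous_on UNIV (\<lambda>x. ((2 * ?V' (x \<bullet> x)) *\<^sub>R x) \<bullet> gradient \<phi> x)"
        by (intro continuous_on_inner continuous_on_scaleR continuous_on_mult_left cV'x D(4) continuous_on_id)
      then show "(\<lambda>x. ((2 * ?V' (x \<bullet> x)) *\<^sub>R x) \<bullet> gradient \<phi> x) \<in> borel_measurable borel"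
        by (rule borel_measurable_continuous_onI)
    qed (simp_all add: D)
    also have "\<dots> = (\<integral>x. (\<Sum>i\<in>I. (- c i / real ?n) * (?K i x * (gradient \<phi> x \<bullet> x))) \<partial>lborel)"
    proof (rule Bochner_Integration.integral_cong[OF refl])
      fix x :: 'a
      have "2 * ?V' (x \<bullet> x) = (\<Sum>i\<in>I. (- c i / real ?n) * ?K i x)"
      proof -
        have "2 * ?V' (x \<bullet> x) = - (\<Sum>i\<in>I. c i * ?K i x) / real ?n"
          by (simp add: kern_inner_self)
        also have "\<dots> = - (\<Sum>i\<in>I. c i / real ?n * ?K i x)"
          by (simp add: sum_divide_distrib mult.commute)
        finally show ?thesis by (simp add: sum_negf)
      qed
      then show "((2 * ?V' (x \<bullet> x)) *\<^sub>R x) \<bullet> gradient \<phi> x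
          = (\<Sum>i\<in>I. (- c i / real ?n) * (?K i x * (gradient \<phi> x \<bullet> x)))"
        by (simp only: inner_scaleR_left sum_distrib_right inner_commute[of x "gradient \<phi> x"] mult.assoc)
    qed
    also have "\<dots> = (\<Sum>i\<in>I. (- c i / real ?n) * (\<integral>x. ?K i x * (gradient \<phi> x \<bullet> x) \<partial>lborel))"
      by (subst Bochner_Integration.integral_sum) (intro integrable_mult_right iK, assumption, intro sum.cong refl integral_mult_right_zero)
    also have "\<dots> = (\<Sum>i\<in>I. c i * (\<integral>x. indicat_real (?S i) x * \<phi> x \<partial>lborel))"
    proof (rule sum.cong[OF refl])
      fix i assume i: "i \<in> I"
      have "(\<integral>x. ?K i x * (gradient \<phi> x \<bullet> x) \<partial>lborel) = - real ?n * (\<integral>x. indicat_real (?S i) x * \<phi> x \<partial>lborel)"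
        by (rule flux_through_spheres[OF has_derivative_gradient[OF D(2)] D(4) Z s[OF i]])
      then show "(- c i / real ?n) * (\<integral>x. ?K i x * (gradient \<phi> x \<bullet> x) \<partial>lborel)
          = c i * (\<integral>x. indicat_real (?S i) x * \<phi> x \<partial>lborel)" by simp
    qed
    also have "\<dots> = (\<integral>x. (\<Sum>i\<in>I. c i * (indicat_real (?S i) x * \<phi> x)) \<partial>lborel)"
      using i\<phi> by (subst Bochner_Integration.integral_sum) auto
    also have "\<dots> = (\<integral>x. indicat_real E x * \<phi> x \<partial>lborel)"
    proof (rule integral_cong_AE)
      have [measurable]: "?S i \<in> sets borel" for i by measurable
      show "(\<lambda>x. \<Sum>i\<in>I. c i * (indicat_real (?S i) x * \<phi> x)) \<in> borel_measurable lborel" by measurable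
      show "(\<lambda>x. indicat_real E x * \<phi> x) \<in> borel_measurable lborel" by measurable
      show "AE x in lborel. (\<Sum>i\<in>I. c i * (indicat_real (?S i) x * \<phi> x)) = indicat_real E x * \<phi> x"
        using ind by eventually_elim (simp add: sum_distrib_right mult.assoc)
    qed
    also have "\<dots> = (\<integral>x. indicat_real E x * \<phi> x \<partial>lebesgue_on ?B)"
      by (rule integral_lebesgue_on_vanishing[symmetric]) (simp_all add: D)
    finally show "(\<integral>x. ((2 * ?V' (x \<bullet> x)) *\<^sub>R x) \<bullet> gradient \<phi> x \<partial>lebesgue_on ?B)
        = (\<integral>x. indicat_real E x * \<phi> x \<partial>lebesgue_on ?B)" .
  qed
qed

text \<open>By continuity, values close to \<open>V 0\<close> are taken on a whole ball around the origin, so the essential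
  supremum does not fall below \<open>V 0\<close>.\<close>
lemma Linf_norm_radial:
  fixes u :: "'a::euclidean_space \<Rightarrow> real" and V :: "real \<Rightarrow> real"
  assumes u: "u \<in> borel_measurable (lebesgue_on (ball 0 1))"
    and eq: "AE x in lebesgue_on (ball 0 1). u x = V (x \<bullet> x)"
    and V: "continuous_on UNIV V" and bd: "\<And>t. 0 \<le> t \<Longrightarrow> t \<le> 1 \<Longrightarrow> 0 \<le> V t \<and> V t \<le> V 0"
  shows "Linf_norm (ball 0 1) u = ereal (V 0)"
proof (rule antisym)
  let ?M = "lebesgue_on (ball (0::'a) 1)"
  have [measurable]: "u \<in> borel_measurable ?M" by fact
  have in_ball: "0 \<le> x \<bullet> x \<and> x \<bullet> x \<le> 1" if "x \<in> ball (0::'a) 1" for x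
    using that by (auto simp: dot_square_norm abs_square_le_1)
  have abs_eq: "AE x in ?M. ereal \<bar>u x\<bar> = ereal (V (x \<bullet> x)) \<and> x \<in> ball 0 1"
    using eq AE_space by eventually_elim (use in_ball bd in \<open>auto simp del: mem_ball\<close>)
  show "Linf_norm (ball 0 1) u \<le> ereal (V 0)"
    unfolding Linf_norm_def
  proof (rule esssup_I)
    show "AE x in ?M. ereal \<bar>u x\<bar> \<le> ereal (V 0)"
      using abs_eq by eventually_elim (use in_ball bd in \<open>auto simp del: mem_ball\<close>)
  qed measurable
  show "ereal (V 0) \<le> Linf_norm (ball 0 1) u"
  proof (rule ccontr)
    assume "\<not> ereal (V 0) \<le> Linf_norm (ball 0 1) u"
    then obtain c where c: "Linf_norm (ball 0 1) u < ereal c" "c < V 0"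
      using ereal_dense2[of "Linf_norm (ball 0 1) u" "ereal (V 0)"] by (auto simp: not_le)
    have "continuous_on UNIV (\<lambda>x::'a. V (x \<bullet> x))"
      by (intro continuous_on_compose2[OF V] continuous_intros) auto
    then have "isCont (\<lambda>x::'a. V (x \<bullet> x)) 0" by (simp add: continuous_on_eq_continuous_at)
    then have "\<forall>\<^sub>F x in at (0::'a). c < V (x \<bullet> x)"
      using c(2) unfolding isCont_def by (intro order_tendstoD(1)) auto
    then have "\<forall>\<^sub>F x in nhds (0::'a). c < V (x \<bullet> x)"
      using c(2) by (simp add: eventually_nhds_conv_at)
    then obtain e where e: "e > 0" "\<And>x::'a. dist x 0 < e \<Longrightarrow> c < V (x \<bullet> x)"
      unfolding eventually_nhds_metric by blast
    define r where "r = min e 1"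
    have r: "r > 0" "r \<le> e" "r \<le> 1" using e by (auto simp: r_def)
    have "AE x in ?M. ereal \<bar>u x\<bar> \<le> Linf_norm (ball 0 1) u"
      unfolding Linf_norm_def by (rule esssup_AE)
    then have "AE x in ?M. x \<notin> ball 0 r"
      using abs_eq
    proof eventually_elim
      fix x :: 'a assume x: "ereal \<bar>u x\<bar> \<le> Linf_norm (ball 0 1) u" "ereal \<bar>u x\<bar> = ereal (V (x \<bullet> x)) \<and> x \<in> ball 0 1"
      then have "ereal (V (x \<bullet> x)) \<le> Linf_norm (ball 0 1) u" by simp
      then have "ereal (V (x \<bullet> x)) < ereal c" using c(1) by (rule le_less_trans)
      then show "x \<notin> ball 0 r" using e(2)[of x] r by (force simp: dist_commute)
    qed
    then have "AE x in lebesgue. x \<in> ball 0 1 \<longrightarrow> x \<notin> ball (0::'a) r"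
      by (subst (asm) AE_restrict_space_iff) auto
    then have "AE x in lebesgue. x \<notin> ball (0::'a) r"
      by (rule eventually_mono) (use r in auto)
    then have "ball (0::'a) r \<in> null_sets lebesgue"
      by (subst (asm) AE_iff_null_sets[symmetric]) auto
    then have "measure lebesgue (ball (0::'a) r) = 0" by (rule measure_eq_0_null_sets)
    then show False using content_ball_pos[OF r(1), of "0::'a"] by simp
  qed
qed

lemma Linf_norm_u_sol:
  fixes V :: "real \<Rightarrow> real" and E :: "'a::euclidean_space set"
  assumes s: "\<And>i. i \<in> I \<Longrightarrow> 0 < s i"
    and E: "E \<in> sets borel"
    and ind: "AE x in lborel. indicator E x = (\<Sum>i\<in>I. c i * indicator {x. norm x ^ DIM('a) < s i} x)"
    and pos: "\<And>t. (\<Sum>i\<in>I. c i * kern DIM('a) (s i) t) \<ge> 0"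
    and V: "\<And>t. (V has_real_derivative - (\<Sum>i\<in>I. c i * kern DIM('a) (s i) t) / (2 * real DIM('a))) (at t)"
    and V1: "V 1 = 0"
  shows "Linf_norm (ball 0 1) (u_sol E) = ereal (V 0)"
proof -
  have w: "weak_Dirichlet_solution (ball 0 1) (indicator E) (\<lambda>x::'a. V (x \<bullet> x))"
    by (rule weak_solution_radial[OF s E ind V V1])
  then have u: "weak_Dirichlet_solution (ball 0 1) (indicator E) (u_sol E)"
    unfolding u_sol_def by (rule someI[where P="weak_Dirichlet_solution (ball 0 1) (indicator E)"])
  have mono: "V b \<le> V a" if "a \<le> b" for a b
  proof (rule DERIV_nonpos_imp_nonincreasing[OF that])
    fix t
    have "- (\<Sum>i\<in>I. c i * kern DIM('a) (s i) t) / (2 * real DIM('a)) \<le> 0"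
      using pos[of t] by (simp add: divide_nonneg_pos)
    then show "\<exists>y. (V has_real_derivative y) (at t) \<and> y \<le> 0" using V by blast
  qed
  show ?thesis
  proof (rule Linf_norm_radial)
    show "u_sol E \<in> borel_measurable (lebesgue_on (ball 0 1))"
      using u unit_ball.H10_L2(1) by (auto simp: weak_Dirichlet_solution_def L2_on_def)
    show "AE x in lebesgue_on (ball 0 1). u_sol E x = V (x \<bullet> x)"
      by (rule unit_ball.weak_solution_unique[OF u w])
    show "continuous_on UNIV V"
      using V by (auto intro!: continuous_at_imp_continuous_on DERIV_isCont)
    show "0 \<le> V t \<and> V t \<le> V 0" if "0 \<le> t" "t \<le> 1" for t
      using mono[OF that(1)] mono[OF that(2)] V1 by simp
  qed
qed

section \<open>The second difference of the kernel\<close>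

text \<open>As a function of \<open>s\<close>, the kernel \<open>min(1, s/\<sigma>)\<close> is concave and piecewise linear with its only
  kink at \<open>s = \<sigma>\<close>. The second difference \<open>D\<close> therefore vanishes unless \<open>\<sigma>\<close> is within distance
  \<open>h\<close> of \<open>m\<close>, and there it is the tent \<open>(h - |\<sigma> - m|)/\<sigma>\<close>.\<close>
lemma kern_second_difference:
  fixes n :: nat and m h t :: real
  defines "\<sigma> \<equiv> sqrt \<bar>t\<bar> ^ n"
  defines "D \<equiv> 2 * kern n m t - kern n (m + h) t - kern n (m - h) t"
  assumes h: "0 < h" "h < m / 2"
  shows "\<bar>\<sigma> - m\<bar> \<ge> h \<Longrightarrow> D = 0" and "0 \<le> D" and "D \<le> 2 * h / m"
    and "\<bar>\<sigma> - m\<bar> \<le> h / 2 \<Longrightarrow> h / (3 * m) \<le> D"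
proof -
  have D: "D = max 0 (h - \<bar>\<sigma> - m\<bar>) / \<sigma>" if "\<sigma> > m - h"
  proof -
    have pos: "\<sigma> > 0" using that h by simp
    consider "\<sigma> \<le> m" | "m < \<sigma>" "\<sigma> \<le> m + h" | "m + h < \<sigma>" by linarith
    then show ?thesis
    proof cases
      case 1
      then have "kern n m t = 1" "kern n (m + h) t = 1" "kern n (m - h) t = (m - h) / \<sigma>"
        using h that by (auto simp: kern_def \<sigma>_def[symmetric] max_def)
      then show ?thesis using 1 that pos by (simp add: D_def field_simps)
    next
      case 2
      then have "kern n m t = m / \<sigma>" "kern n (m + h) t = 1" "kern n (m - h) t = (m - h) / \<sigma>"
        using h that by (auto simp: kern_def \<sigma>_def[symmetric] max_def)
      then show ?thesis using 2 that pos by (simp add: D_def field_simps)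
    next
      case 3
      then have "kern n m t = m / \<sigma>" "kern n (m + h) t = (m + h) / \<sigma>" "kern n (m - h) t = (m - h) / \<sigma>"
        using h that by (auto simp: kern_def \<sigma>_def[symmetric] max_def)
      then have "D = (2 * m - (m + h) - (m - h)) / \<sigma>"
        unfolding D_def by (simp add: diff_divide_distrib add_divide_distrib)
      then show ?thesis using 3 by simp
    qed
  qed
  have D0: "D = 0" if "\<sigma> \<le> m - h"
  proof -
    have "kern n m t = 1" "kern n (m + h) t = 1" "kern n (m - h) t = 1"
      using h that by (auto simp: kern_def \<sigma>_def[symmetric] max_def)
    then show ?thesis by (simp add: D_def)
  qed
  show "D = 0" if "\<bar>\<sigma> - m\<bar> \<ge> h"
  proof (cases "\<sigma> > m - h")
    case True then show ?thesis using D that by simp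
  qed (use D0 in simp)
  show "0 \<le> D"
  proof (cases "\<sigma> > m - h")
    case True then show ?thesis using D h by simp
  qed (use D0 in simp)
  show "D \<le> 2 * h / m"
  proof (cases "\<sigma> > m - h")
    case True
    have "D \<le> h / (m / 2)" unfolding D[OF True] using True h by (intro frac_le) auto
    then show ?thesis by (simp add: mult.commute)
  qed (use D0 h in simp)
  show "h / (3 * m) \<le> D" if "\<bar>\<sigma> - m\<bar> \<le> h / 2"
  proof -
    have s: "\<sigma> > m - h" "\<sigma> \<le> 3 * m / 2" using that h by linarith+
    have "h / (3 * m) = (h / 2) / (3 * m / 2)" by simp
    also have "\<dots> \<le> D" unfolding D[OF s(1)] using s that h by (intro frac_le) auto
    finally show ?thesis .
  qed
qed

lemma sqrt_powr_power:
  assumes "n > 0" "y > 0" shows "sqrt \<bar>y powr (2 / real n)\<bar> ^ n = y"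
proof -
  have "sqrt \<bar>y powr (2 / real n)\<bar> ^ n = ((y powr (2 / real n)) powr (1/2)) powr real n"
    using assms by (simp add: powr_half_sqrt powr_realpow)
  also have "\<dots> = y" using assms by (simp add: powr_powr)
  finally show ?thesis .
qed

text \<open>Mean value theorem for \<open>y\<^sup>2\<^sup>/\<^sup>n\<close>. The exponent \<open>2/n - 1\<close> of the derivative lies between \<open>-1\<close> and
  \<open>1\<close>, so on \<open>(0,1]\<close> the power is between \<open>z\<close> and \<open>1/z\<close>. It turns bounds on volumes into bounds
  on squared radii.\<close>
lemma powr_diff_bounds:
  fixes m y1 y2 :: real
  assumes "n > 0" "0 < m" "m / 2 \<le> y1" "y1 < y2" "y2 \<le> 1"
  shows "(y2 - y1) * (m / real n) \<le> y2 powr (2 / real n) - y1 powr (2 / real n)"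
    and "y2 powr (2 / real n) - y1 powr (2 / real n) \<le> (y2 - y1) * (4 / (m * real n))"
proof -
  let ?p = "2 / real n"
  have n: "real n \<ge> 1" using assms(1) by simp
  have "\<exists>z. y1 < z \<and> z < y2 \<and> y2 powr ?p - y1 powr ?p = (y2 - y1) * (?p * z powr (?p - 1))"
    using assms by (intro MVT2 has_real_derivative_powr) auto
  then obtain z where z: "y1 < z" "z < y2" "y2 powr ?p - y1 powr ?p = (y2 - y1) * (?p * z powr (?p - 1))"
    by blast
  have z01: "m / 2 \<le> z" "0 < z" "z \<le> 1" using z assms by auto
  have "z powr 1 \<le> z powr (?p - 1)"
    using z01 n by (intro powr_mono') (auto simp: field_simps)
  then have lo: "m / 2 \<le> z powr (?p - 1)" using z01 by simp
  have "z powr (?p - 1) \<le> z powr (- 1)"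
    using z01 n by (intro powr_mono') (auto simp: field_simps)
  also have "\<dots> = 1 / z" using z01 by (simp add: powr_minus_divide)
  also have "\<dots> \<le> 1 / (m / 2)" using z01 assms by (intro divide_left_mono) auto
  finally have hi: "z powr (?p - 1) \<le> 2 / m" by simp
  have "?p * (m / 2) \<le> ?p * z powr (?p - 1)" by (intro mult_left_mono lo) simp
  then have "m / real n \<le> ?p * z powr (?p - 1)" by simp
  then show "(y2 - y1) * (m / real n) \<le> y2 powr ?p - y1 powr ?p"
    unfolding z(3) using assms by (intro mult_left_mono) auto
  have "?p * z powr (?p - 1) \<le> ?p * (2 / m)" by (intro mult_left_mono hi) simp
  then have "?p * z powr (?p - 1) \<le> 4 / (m * real n)" by (simp add: mult.commute)
  then show "y2 powr ?p - y1 powr ?p \<le> (y2 - y1) * (4 / (m * real n))"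
    unfolding z(3) using assms by (intro mult_left_mono) auto
qed

text \<open>In \<open>[0,1]\<close> the derivative of \<open>W\<close> is nonpositive and lives on an interval of length of order
  \<open>h\<close>; there it is at most of order \<open>h\<close>, and of exact order \<open>h\<close> in the middle part. Hence \<open>W\<close> drops by an amount of order \<open>h\<^sup>2\<close>.\<close>
lemma second_difference_estimate:
  fixes W :: "real \<Rightarrow> real"
  assumes n: "n > 0" and h: "0 < h" "h < m / 2" "m + h < 1"
    and W: "\<And>t. (W has_real_derivative
        - (2 * kern n m t - kern n (m + h) t - kern n (m - h) t) / (2 * real n)) (at t)"
  shows "h\<^sup>2 / (6 * (real n)\<^sup>2) \<le> W 0 - W 1" and "W 0 - W 1 \<le> 8 * h\<^sup>2 / (m * real n)\<^sup>2"
proof -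
  define D where "D t = 2 * kern n m t - kern n (m + h) t - kern n (m - h) t" for t
  have W: "(W has_real_derivative - D t / (2 * real n)) (at t)" for t using W by (simp add: D_def)
  note D = kern_second_difference[where n=n and t=t and m=m and h=h for t, OF h(1,2), folded D_def]
  (* \<tau> y is the squared radius at which the volume parameter sqrt t ^ n equals y. *)
  define \<tau> where "\<tau> y = y powr (2 / real n)" for y
  have m: "m > 0" using h by simp
  have \<tau>: "sqrt \<bar>\<tau> y\<bar> ^ n = y" if "y > 0" for y
    unfolding \<tau>_def using sqrt_powr_power[OF n that] .
  have \<tau>0: "\<tau> y \<ge> 0" for y by (simp add: \<tau>_def)
  have \<tau>_mono: "\<tau> x \<le> \<tau> y" if "0 < x" "x \<le> y" for x y
    unfolding \<tau>_def using that by (intro powr_mono2) auto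
  have \<tau>1: "\<tau> 1 = 1" by (simp add: \<tau>_def)
  have below: "sqrt \<bar>t\<bar> ^ n \<le> y" if "0 \<le> t" "t \<le> \<tau> y" "y > 0" for t y
  proof -
    have "sqrt \<bar>t\<bar> ^ n \<le> sqrt \<bar>\<tau> y\<bar> ^ n" using that by (intro power_mono real_sqrt_le_mono) auto
    then show ?thesis using \<tau>[OF that(3)] by simp
  qed
  have above: "y \<le> sqrt \<bar>t\<bar> ^ n" if "\<tau> y \<le> t" "y > 0" for t y
  proof -
    have "sqrt \<bar>\<tau> y\<bar> ^ n \<le> sqrt \<bar>t\<bar> ^ n" using that \<tau>0[of y] by (intro power_mono real_sqrt_le_mono) auto
    then show ?thesis using \<tau>[OF that(2)] by simp
  qed
  have mvt: "\<exists>z. a < z \<and> z < b \<and> W a - W b = (b - a) * (D z / (2 * real n))" if "a < b" for a b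
    using MVT2[OF that W] by (auto simp: algebra_simps)
  have decr: "W b \<le> W a" if "a \<le> b" for a b
  proof (cases "a = b")
    case False
    then have "a < b" using that by simp
    then obtain z where "W a - W b = (b - a) * (D z / (2 * real n))" using mvt by blast
    moreover have "0 \<le> (b - a) * (D z / (2 * real n))" using that D(2)[of z] by simp
    ultimately show ?thesis by simp
  qed simp
  have flat: "W a = W b" if "a \<le> b" "\<And>t. a \<le> t \<Longrightarrow> t \<le> b \<Longrightarrow> D t = 0" for a b
  proof (cases "a = b")
    case False
    then have "a < b" using that by simp
    then obtain z where "a < z" "z < b" "W a - W b = (b - a) * (D z / (2 * real n))" using mvt by blast
    then show ?thesis using that(2)[of z] by simp
  qed simp
  show "W 0 - W 1 \<le> 8 * h\<^sup>2 / (m * real n)\<^sup>2"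
  proof -
    let ?a = "\<tau> (m - h)" and ?b = "\<tau> (m + h)"
    have "W 0 = W ?a"
    proof (rule flat[OF \<tau>0])
      show "D t = 0" if "0 \<le> t" "t \<le> ?a" for t
        using below[OF that] h by (intro D(1)) auto
    qed
    moreover have "W ?b = W 1"
    proof (rule flat)
      show "?b \<le> 1" using \<tau>_mono[of "m + h" 1] h m \<tau>1 by simp
      show "D t = 0" if "?b \<le> t" for t
        using above[OF that] h m by (intro D(1)) auto
    qed
    moreover have len: "?b - ?a \<le> 2 * h * (4 / (m * real n))"
      using powr_diff_bounds(2)[of n m "m - h" "m + h"] n h m by (simp add: \<tau>_def)
    have "?a < ?b"
      unfolding \<tau>_def using n h m by (intro powr_less_mono2) auto
    then obtain z where "W ?a - W ?b = (?b - ?a) * (D z / (2 * real n))" using mvt by blast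
    moreover have "(?b - ?a) * (D z / (2 * real n)) \<le> 2 * h * (4 / (m * real n)) * ((2 * h / m) / (2 * real n))"
      using len D(2,3)[of z] \<open>?a < ?b\<close> h m n by (intro mult_mono divide_right_mono) auto
    moreover have "2 * h * (4 / (m * real n)) * ((2 * h / m) / (2 * real n)) = 8 * h\<^sup>2 / (m * real n)\<^sup>2"
      using m n by (simp add: field_simps power2_eq_square)
    ultimately show ?thesis by linarith
  qed
  show "h\<^sup>2 / (6 * (real n)\<^sup>2) \<le> W 0 - W 1"
  proof -
    let ?a = "\<tau> (m - h / 2)" and ?b = "\<tau> (m + h / 2)"
    have "W ?a \<le> W 0" by (rule decr[OF \<tau>0])
    moreover have "W 1 \<le> W ?b" using \<tau>_mono[of "m + h / 2" 1] h m \<tau>1 by (intro decr) simp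
    moreover have len: "h * (m / real n) \<le> ?b - ?a"
      using powr_diff_bounds(1)[of n m "m - h / 2" "m + h / 2"] n h m by (simp add: \<tau>_def)
    have ab: "?a < ?b"
      unfolding \<tau>_def using n h m by (intro powr_less_mono2) auto
    then obtain z where z: "?a < z" "z < ?b" "W ?a - W ?b = (?b - ?a) * (D z / (2 * real n))" using mvt by blast
    have "m - h / 2 \<le> sqrt \<bar>z\<bar> ^ n" "sqrt \<bar>z\<bar> ^ n \<le> m + h / 2"
      using above[of "m - h / 2" z] below[of z "m + h / 2"] z \<tau>0[of "m - h / 2"] h m by auto
    then have "h / (3 * m) \<le> D z" by (intro D(4)) linarith
    then have "h * (m / real n) * ((h / (3 * m)) / (2 * real n)) \<le> (?b - ?a) * (D z / (2 * real n))"
      using len ab h m n by (intro mult_mono divide_right_mono) auto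
    moreover have "h * (m / real n) * ((h / (3 * m)) / (2 * real n)) = h\<^sup>2 / (6 * (real n)\<^sup>2)"
      using m n by (simp add: field_simps power2_eq_square)
    ultimately show ?thesis using z(3) by linarith
  qed
qed

section \<open>The ball and its competitor\<close>

lemma kern_mono:
  assumes "0 < s" "s \<le> s'" shows "kern n s t \<le> kern n s' t"
proof -
  let ?c = "sqrt \<bar>t\<bar> ^ n"
  have "s * ?c \<le> s' * ?c" using assms by (intro mult_right_mono) auto
  then have "max (s * s') (s * ?c) \<le> max (s' * s) (s' * ?c)"
    by (intro max.mono) (simp_all add: mult.commute)
  then have "s * max s' ?c \<le> s' * max s ?c"
    using assms by (simp add: max_mult_distrib_left)
  moreover have "max s ?c > 0" "max s' ?c > 0" using assms by (auto simp: less_max_iff_disj)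
  ultimately show ?thesis unfolding kern_def by (simp add: field_simps)
qed

lemma kern_nonneg: "0 < s \<Longrightarrow> 0 \<le> kern n s t"
  by (simp add: kern_def le_max_iff_disj)

lemma less_iff_power_less:
  fixes a b :: real
  assumes "n > 0" "a \<ge> 0" "b \<ge> 0" shows "a < b \<longleftrightarrow> a ^ n < b ^ n"
  using power_strict_mono[of a b n] power_less_imp_less_base[of a n b] assms by blast

lemma measure_ball_power:
  "r \<ge> 0 \<Longrightarrow> measure lebesgue (ball (0::'a::euclidean_space) r) = measure lebesgue (ball (0::'a) 1) * r ^ DIM('a)"
  by (simp add: content_ball)

lemma r_star_power:
  fixes m :: real
  defines "\<omega> \<equiv> measure lebesgue (ball (0::'a::euclidean_space) 1)"
  assumes m: "0 < m"
  shows "r_star TYPE('a) m > 0" and "r_star TYPE('a) m ^ DIM('a) = m / \<omega>"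
proof -
  have \<omega>: "\<omega> > 0" by (simp add: \<omega>_def)
  let ?P = "\<lambda>r. 0 < r \<and> measure lebesgue (ball (0::'a) r) = m"
  have iff: "?P r \<longleftrightarrow> 0 < r \<and> r ^ DIM('a) = m / \<omega>" for r
    using measure_ball_power[of r, where 'a='a] \<omega> by (auto simp: \<omega>_def field_simps)
  have "\<exists>!r. ?P r"
  proof (rule ex1I)
    show "?P (root DIM('a) (m / \<omega>))" unfolding iff using m \<omega> by simp
    show "r = root DIM('a) (m / \<omega>)" if "?P r" for r
      using that unfolding iff by (metis DIM_positive less_imp_le real_root_power_cancel)
  qed
  then have "?P (r_star TYPE('a) m)" unfolding r_star_def by (rule theI')
  then show "r_star TYPE('a) m > 0" "r_star TYPE('a) m ^ DIM('a) = m / \<omega>" unfolding iff by auto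
qed

lemma powr_quotient_power:
  assumes "a > 0" "b > 0" "n > 0"
  shows "(a powr (1 / real n) / b powr (1 / real n)) ^ n = a / b"
  using assms by (simp add: power_divide powr_realpow[symmetric] powr_powr)

text \<open>With \<open>\<mu> = m/\<omega>\<close> and \<open>h = \<delta>/(2\<omega>)\<close>, the ball is \<open>|x|\<^sup>n < \<mu>\<close>, and the competitor is, up to
  a sphere, the balls with parameters \<open>\<mu> - h\<close> and \<open>\<mu> + h\<close> added together minus the one with
  parameter \<open>\<mu>\<close>. The difference of the two profiles is therefore governed by the second difference
  of the kernel. Both norms are values at the origin.\<close>
lemma Linf_deficit:
  fixes m \<delta> :: real
  defines "\<omega> \<equiv> measure lebesgue (ball (0::'a::euclidean_space) 1)" and "n \<equiv> DIM('a)"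
  assumes m: "0 < m" and \<delta>: "0 < \<delta>" "\<delta> < m" "\<delta> < \<omega> - m"
  obtains d where "Linf_norm (ball 0 1) (u_sol (B_star m :: 'a set))
      - Linf_norm (ball 0 1) (u_sol (A_set m \<delta> :: 'a set)) = ereal d"
    and "\<delta>\<^sup>2 / (24 * (real n)\<^sup>2 * \<omega>\<^sup>2) \<le> d" and "d \<le> 2 * \<delta>\<^sup>2 / (m * real n)\<^sup>2"
proof -
  have n: "n > 0" by (simp add: n_def)
  have \<omega>: "\<omega> > 0" by (simp add: \<omega>_def)
  define \<mu> where "\<mu> = m / \<omega>"
  define h where "h = \<delta> / (2 * \<omega>)"
  have \<mu>: "\<mu> > 0" using m \<omega> by (simp add: \<mu>_def)
  have h: "0 < h" "h < \<mu> / 2" "\<mu> + h < 1"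
    using \<delta> \<omega> by (auto simp: h_def \<mu>_def field_simps)
  note rs = r_star_power[OF m, where 'a='a, folded \<omega>_def n_def \<mu>_def]
  have r1: "r1 TYPE('a) m \<delta> ^ n = \<mu> - h" "r1 TYPE('a) m \<delta> \<ge> 0"
    using powr_quotient_power[of "m - \<delta> / 2" \<omega> n] \<delta> \<omega> n
    by (simp_all add: r1_def \<omega>_def[symmetric] n_def[symmetric] \<mu>_def h_def field_simps)
  have r2: "r2 TYPE('a) m \<delta> ^ n = \<mu> + h" "r2 TYPE('a) m \<delta> \<ge> 0"
    using powr_quotient_power[of "m + \<delta> / 2" \<omega> n] \<delta> \<omega> n m
    by (simp_all add: r2_def \<omega>_def[symmetric] n_def[symmetric] \<mu>_def h_def field_simps)
  have less_star: "norm x < r_star TYPE('a) m \<longleftrightarrow> norm x ^ n < \<mu>"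
    and star_less: "r_star TYPE('a) m < norm x \<longleftrightarrow> \<mu> < norm x ^ n"
    and less_r1: "norm x < r1 TYPE('a) m \<delta> \<longleftrightarrow> norm x ^ n < \<mu> - h"
    and less_r2: "norm x < r2 TYPE('a) m \<delta> \<longleftrightarrow> norm x ^ n < \<mu> + h" for x :: 'a
    using less_iff_power_less[OF n norm_ge_zero less_imp_le[OF rs(1)], of x]
      less_iff_power_less[OF n less_imp_le[OF rs(1)] norm_ge_zero, of x]
      less_iff_power_less[OF n norm_ge_zero r1(2), of x] less_iff_power_less[OF n norm_ge_zero r2(2), of x]
    unfolding rs(2) r1(1) r2(1) .
  have B_eq: "(B_star m :: 'a set) = {x. norm x ^ n < \<mu>}"
    by (simp add: B_star_def set_eq_iff less_star)
  have A_eq: "(A_set m \<delta> :: 'a set) = {x. norm x ^ n < \<mu> - h} \<union> {x. \<mu> < norm x ^ n \<and> norm x ^ n < \<mu> + h}"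
    by (simp add: A_set_def set_eq_iff star_less less_r1 less_r2)
  obtain VB where VB: "\<And>t. (VB has_real_derivative - (\<Sum>s\<in>{\<mu>}. 1 * kern n s t) / (2 * real n)) (at t)" "VB 1 = 0"
  proof (rule antiderivative_exists)
    show "continuous_on UNIV (\<lambda>t. - (\<Sum>s\<in>{\<mu>}. 1 * kern n s t) / (2 * real n))"
      using \<mu> n by (intro continuous_intros continuous_kern) auto
  qed blast
  have B: "Linf_norm (ball 0 1) (u_sol (B_star m :: 'a set)) = ereal (VB 0)"
  proof (rule Linf_norm_u_sol[where 'a='a and I="{\<mu>}" and s="\<lambda>s. s" and c="\<lambda>_. 1", folded n_def])
    show "(B_star m :: 'a set) \<in> sets borel" by (simp add: B_star_def)
    show "(\<Sum>s\<in>{\<mu>}. 1 * kern n s t) \<ge> 0" for t using kern_nonneg[OF \<mu>] by simp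
  qed (use \<mu> VB in \<open>auto simp: B_eq\<close>)
  (* The three volume parameters are distinct, so they can index the balls of the superposition. *)
  define c where "c s = (if s = \<mu> then - 1 else 1 :: real)" for s
  let ?I = "{\<mu> - h, \<mu> + h, \<mu>}"
  have I: "(\<Sum>s\<in>?I. c s * f s) = f (\<mu> - h) + f (\<mu> + h) - f \<mu>" for f :: "real \<Rightarrow> real"
    using h by (simp add: c_def)
  have Ipos: "0 < s" if "s \<in> ?I" for s using that h \<mu> by auto
  obtain VA where VA: "\<And>t. (VA has_real_derivative - (\<Sum>s\<in>?I. c s * kern n s t) / (2 * real n)) (at t)" "VA 1 = 0"
  proof (rule antiderivative_exists)
    show "continuous_on UNIV (\<lambda>t. - (\<Sum>s\<in>?I. c s * kern n s t) / (2 * real n))"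
      using n by (intro continuous_intros continuous_kern Ipos) auto
  qed blast
  have A: "Linf_norm (ball 0 1) (u_sol (A_set m \<delta> :: 'a set)) = ereal (VA 0)"
  proof (rule Linf_norm_u_sol[where 'a='a and I="?I" and s="\<lambda>s. s" and c=c, folded n_def])
    show "(A_set m \<delta> :: 'a set) \<in> sets borel" unfolding A_eq by measurable
    show "(\<Sum>s\<in>?I. c s * kern n s t) \<ge> 0" for t
      unfolding I using kern_mono[OF \<mu>, of "\<mu> + h" n t] kern_nonneg[of "\<mu> - h" n t] h by simp
    show "AE x in lborel. indicator (A_set m \<delta>) x = (\<Sum>s\<in>?I. c s * indicator {x::'a. norm x ^ n < s} x)"
      using AE_norm_neq[of "r_star TYPE('a) m"]
    proof eventually_elim
      fix x :: 'a assume "norm x \<noteq> r_star TYPE('a) m"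
      then have "norm x ^ n \<noteq> \<mu>"
        using rs n by (metis less_imp_le norm_ge_zero power_eq_imp_eq_base)
      then show "indicator (A_set m \<delta>) x = (\<Sum>s\<in>?I. c s * indicator {x::'a. norm x ^ n < s} x)"
        unfolding I A_eq using h by (auto simp: indicator_def)
    qed
  qed (use Ipos VA in auto)
  have "((\<lambda>t. VB t - VA t) has_real_derivative
      - (2 * kern n \<mu> t - kern n (\<mu> + h) t - kern n (\<mu> - h) t) / (2 * real n)) (at t)" for t
    by (rule DERIV_cong[OF DERIV_diff[OF VB(1) VA(1)]]) (simp add: I add_divide_distrib diff_divide_distrib)
  note est = second_difference_estimate[OF n h this]
  show ?thesis
  proof (rule that[of "VB 0 - VA 0"])
    show "Linf_norm (ball 0 1) (u_sol (B_star m :: 'a set))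
      - Linf_norm (ball 0 1) (u_sol (A_set m \<delta> :: 'a set)) = ereal (VB 0 - VA 0)"
      by (simp add: A B)
    have "\<delta>\<^sup>2 / (24 * (real n)\<^sup>2 * \<omega>\<^sup>2) = h\<^sup>2 / (6 * (real n)\<^sup>2)"
      by (simp add: h_def power_divide power_mult_distrib mult_ac)
    then show "\<delta>\<^sup>2 / (24 * (real n)\<^sup>2 * \<omega>\<^sup>2) \<le> VB 0 - VA 0"
      using est(1) VA(2) VB(2) by simp
    have "8 * h\<^sup>2 / (\<mu> * real n)\<^sup>2 = 2 * \<delta>\<^sup>2 / (m * real n)\<^sup>2"
      using \<omega> by (simp add: h_def \<mu>_def power_divide power_mult_distrib field_simps)
    then show "VB 0 - VA 0 \<le> 2 * \<delta>\<^sup>2 / (m * real n)\<^sup>2"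
      using est(2) VA(2) VB(2) by simp
  qed
qed

theorem proposition2p17:
  fixes m :: real
  assumes "0 < m" and "m < measure lebesgue (ball (0 :: real ^ 'n) 1)"
  shows "\<exists>\<delta>bar C. 0 < \<delta>bar \<and>
           \<delta>bar \<le> min (2 * m) (2 * (measure lebesgue (ball (0 :: real ^ 'n) 1) - m)) \<and> 0 < C \<and>
           (\<forall>\<delta>. 0 < \<delta> \<and> \<delta> < \<delta>bar \<longrightarrow>
              ereal (1 / C * \<delta>\<^sup>2)
                \<le> Linf_norm (ball 0 1) (u_sol (B_star m :: (real ^ 'n) set))
                  - Linf_norm (ball 0 1) (u_sol (A_set m \<delta> :: (real ^ 'n) set)) \<and>
              Linf_norm (ball 0 1) (u_sol (B_star m :: (real ^ 'n) set))
                  - Linf_norm (ball 0 1) (u_sol (A_set m \<delta> :: (real ^ 'n) set))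
                \<le> ereal (C * \<delta>\<^sup>2))"
proof -
  define \<omega> where "\<omega> = measure lebesgue (ball (0 :: real ^ 'n) 1)"
  define n where "n = real DIM(real ^ 'n)"
  have n: "n > 0" by (simp add: n_def)
  have \<omega>: "\<omega> > 0" "m < \<omega>" using assms by (auto simp: \<omega>_def)
  define C where "C = max (24 * n\<^sup>2 * \<omega>\<^sup>2) (2 / (m * n)\<^sup>2)"
  have C0: "24 * n\<^sup>2 * \<omega>\<^sup>2 > 0" using n \<omega> by simp
  have C: "C > 0" "24 * n\<^sup>2 * \<omega>\<^sup>2 \<le> C" "2 / (m * n)\<^sup>2 \<le> C" using C0 by (auto simp: C_def less_max_iff_disj)
  show ?thesis
  proof (unfold \<omega>_def[symmetric], rule exI[of _ "min m (\<omega> - m)"], rule exI[of _ C], intro conjI allI impI)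
    fix \<delta> assume \<delta>: "0 < \<delta> \<and> \<delta> < min m (\<omega> - m)"
    obtain d where d: "Linf_norm (ball 0 1) (u_sol (B_star m :: (real ^ 'n) set))
          - Linf_norm (ball 0 1) (u_sol (A_set m \<delta> :: (real ^ 'n) set)) = ereal d"
      "\<delta>\<^sup>2 / (24 * n\<^sup>2 * \<omega>\<^sup>2) \<le> d" "d \<le> 2 * \<delta>\<^sup>2 / (m * n)\<^sup>2"
      using Linf_deficit[where 'a="real ^ 'n", of m \<delta>, folded \<omega>_def n_def] \<delta> assms(1) by auto
    have "1 / C * \<delta>\<^sup>2 \<le> \<delta>\<^sup>2 / (24 * n\<^sup>2 * \<omega>\<^sup>2)"
      unfolding times_divide_eq_left mult_1 by (intro divide_left_mono C(2) zero_le_power2 mult_pos_pos C(1) C0)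
    then show "ereal (1 / C * \<delta>\<^sup>2)
        \<le> Linf_norm (ball 0 1) (u_sol (B_star m :: (real ^ 'n) set))
          - Linf_norm (ball 0 1) (u_sol (A_set m \<delta> :: (real ^ 'n) set))"
      using d by simp
    have "2 * \<delta>\<^sup>2 / (m * n)\<^sup>2 \<le> C * \<delta>\<^sup>2"
      using mult_right_mono[OF C(3), of "\<delta>\<^sup>2"] by simp
    then show "Linf_norm (ball 0 1) (u_sol (B_star m :: (real ^ 'n) set))
          - Linf_norm (ball 0 1) (u_sol (A_set m \<delta> :: (real ^ 'n) set)) \<le> ereal (C * \<delta>\<^sup>2)"
      using d by simp
  qed (use assms \<omega> C in auto)
qed

end
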